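(* Let $\Upsilon_{\#}:[0,\infty)\to[0,\infty)$ be given by $\Upsilon_{\#}(s):=\min\{1,s\}+\max\{0,\ln s\}$, i.e. $\Upsilon_{\#}(s)=s$ if $s\le1$ and $\Upsilon_{\#}(s)=1+\ln s$ if $s>1$. Let $\Upsilon$ be any modulus of continuity such that $\Upsilon_{\#}\le C\,\Upsilon$ on $[0,\infty)$ for some finite constant $C>0$, and let $n\in\mathbb{N}$. Then for every $f\in\mathrm{VMO}(\mathbb{R}^n)$ there is a sequence $\{f_j\}_{j\in\mathbb{N}}\subset\mathscr{C}^{\Upsilon}(\mathbb{R}^n)\cap C^\infty(\mathbb{R}^n)\cap\mathrm{BMO}(\mathbb{R}^n)$ with $\|f-f_j\|_{\mathrm{BMO}(\mathbb{R}^n)}\to0$ as $j\to\infty$; in short, $\mathscr{C}^{\Upsilon}(\mathbb{R}^n)\cap C^\infty(\mathbb{R}^n)\cap\mathrm{BMO}(\mathbb{R}^n)$ is dense in $\mathrm{VMO}(\mathbb{R}^n)$. In fact, the smaller space consisting of all $f\in\mathscr{C}^{\Upsilon}(\mathbb{R}^n)\cap C^\infty(\mathbb{R}^n)\cap\mathrm{BMO}(\mathbb{R}^n)$ such that $\partial^\alpha f\in\mathscr{C}^{\Upsilon}(\mathbb{R}^n)\cap L^\infty(\mathbb{R}^n)$ for every multi-index $\alpha\in\mathbb{N}_0^n$ with $|\alpha|\ge1$ is also dense in $\mathrm{VMO}(\mathbb{R}^n)$.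
   Context: A modulus of continuity is a nondecreasing function $\Upsilon:[0,\infty)\to[0,\infty]$ with $\lim_{s\to0^+}\Upsilon(s)=0$. $\mathscr{C}^{\Upsilon}(\mathbb{R}^n)$ is the space of functions $f:\mathbb{R}^n\to\mathbb{C}$ for which there is $C\in(0,\infty)$ with $|f(a)-f(b)|\le C\,\Upsilon(|a-b|)$ for all $a,b\in\mathbb{R}^n$. $\mathrm{BMO}(\mathbb{R}^n)$ is the space of $f\in L^1_{\rm loc}(\mathbb{R}^n)$ (complex-valued) with $\|f\|_{\mathrm{BMO}(\mathbb{R}^n)}:=\sup_Q|Q|^{-1}\int_Q|f-f_Q|\,dx<\infty$, the supremum being over all cubes $Q\subset\mathbb{R}^n$ with sides parallel to the axes, where $f_Q:=|Q|^{-1}\int_Qf$. $\mathrm{VMO}(\mathbb{R}^n)$ is the space of $f\in\mathrm{BMO}(\mathbb{R}^n)$ with $\lim_{r\to0^+}\sup_{\ell(Q)\le r}|Q|^{-1}\int_Q|f-f_Q|\,dx=0$, where $\ell(Q)$ is the side-length of $Q$. Density in $\mathrm{VMO}(\mathbb{R}^n)$ is with respect to the seminorm $\|\cdot\|_{\mathrm{BMO}(\mathbb{R}^n)}$ (and includes being a subset of $\mathrm{VMO}(\mathbb{R}^n)$). *)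

theory Defs
  imports "HOL-Analysis.Analysis" "HOL-Library.Multiset"
begin

text \<open>
  A modulus of continuity is a function on the half-line \<open>[0,\<infinity>)\<close> with values in \<open>[0,\<infinity>]\<close>.
  It is modelled by a total function of type \<^typ>\<open>real \<Rightarrow> ennreal\<close>;
  values at negative arguments are never used.
\<close>

definition modulus_of_continuity :: "(real \<Rightarrow> ennreal) \<Rightarrow> bool" where
  "modulus_of_continuity \<Upsilon> \<longleftrightarrow> mono_on {0..} \<Upsilon> \<and> (\<Upsilon> \<longlongrightarrow> 0) (at_right 0)"

text \<open>At \<open>s = 0\<close> the value \<open>ln 0 = 0\<close> is harmless, since only \<open>max 0 (ln s)\<close> enters.\<close>

definition Upsilon_sharp :: "real \<Rightarrow> real" where
  "Upsilon_sharp s = min 1 s + max 0 (ln s)"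

lemma Upsilon_sharp_piecewise:
  assumes "0 \<le> s"
  shows "Upsilon_sharp s = (if s \<le> 1 then s else 1 + ln s)"
  using assms by (cases "s = 0") (auto simp: Upsilon_sharp_def max_def)

definition C_modulus :: "(real \<Rightarrow> ennreal) \<Rightarrow> (real ^ 'n \<Rightarrow> complex) set" where
  "C_modulus \<Upsilon> = {f. \<exists>C::real. 0 < C \<and>
     (\<forall>a b. ennreal (norm (f a - f b)) \<le> ennreal C * \<Upsilon> (norm (a - b)))}"

definition L1_loc :: "(real ^ 'n \<Rightarrow> complex) set" where
  "L1_loc = {f. \<forall>K. compact K \<longrightarrow> set_integrable lebesgue K f}"

definition L_infinity :: "(real ^ 'n \<Rightarrow> complex) set" where
  "L_infinity = {f. f \<in> borel_measurable lebesgue \<and> (\<exists>C. AE x in lebesgue. norm (f x) \<le> C)}"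

text \<open>The closed cube with lower corner \<open>a\<close> and side-length \<open>l\<close>, sides parallel to the axes.\<close>

definition cube :: "real ^ 'n \<Rightarrow> real \<Rightarrow> (real ^ 'n) set" where
  "cube a l = cbox a (a + vec l)"

definition average :: "(real ^ 'n) set \<Rightarrow> (real ^ 'n \<Rightarrow> complex) \<Rightarrow> complex" where
  "average Q f = (1 / measure lebesgue Q) *\<^sub>R (LINT x:Q|lebesgue. f x)"

definition mean_oscillation :: "(real ^ 'n) set \<Rightarrow> (real ^ 'n \<Rightarrow> complex) \<Rightarrow> real" where
  "mean_oscillation Q f =
     1 / measure lebesgue Q * (LINT x:Q|lebesgue. norm (f x - average Q f))"

text \<open>Both suprema are taken in \<^typ>\<open>ennreal\<close>, so that they may be infinite.\<close>

definition BMO_seminorm :: "(real ^ 'n \<Rightarrow> complex) \<Rightarrow> ennreal" where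
  "BMO_seminorm f = (SUP (a, l) \<in> UNIV \<times> {0<..}. ennreal (mean_oscillation (cube a l) f))"

definition BMO :: "(real ^ 'n \<Rightarrow> complex) set" where
  "BMO = {f. f \<in> L1_loc \<and> BMO_seminorm f < \<infinity>}"

definition VMO :: "(real ^ 'n \<Rightarrow> complex) set" where
  "VMO = {f. f \<in> BMO \<and>
     ((\<lambda>r. SUP (a, l) \<in> UNIV \<times> {0<..r}. ennreal (mean_oscillation (cube a l) f))
        \<longlongrightarrow> 0) (at_right 0)}"

definition dense_in_VMO :: "(real ^ 'n \<Rightarrow> complex) set \<Rightarrow> bool" where
  "dense_in_VMO X \<longleftrightarrow> X \<subseteq> VMO \<and>
     (\<forall>f\<in>VMO. \<exists>F :: nat \<Rightarrow> real ^ 'n \<Rightarrow> complex.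
        (\<forall>j. F j \<in> X) \<and> (\<lambda>j. BMO_seminorm (\<lambda>x. f x - F j x)) \<longlonglongrightarrow> 0)"

definition partial :: "'n \<Rightarrow> (real ^ 'n \<Rightarrow> complex) \<Rightarrow> real ^ 'n \<Rightarrow> complex" where
  "partial i f x = vector_derivative (\<lambda>t. f (x + t *\<^sub>R axis i 1)) (at 0)"

definition iterated_partial :: "'n list \<Rightarrow> (real ^ 'n \<Rightarrow> complex) \<Rightarrow> real ^ 'n \<Rightarrow> complex" where
  "iterated_partial xs f = foldr partial xs f"

text \<open>
  A function is smooth if all its iterated partial derivatives exist everywhere and are continuous.
\<close>

definition C_infinity :: "(real ^ 'n \<Rightarrow> complex) set" where
  "C_infinity = {f. \<forall>xs. continuous_on UNIV (iterated_partial xs f) \<and>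
     (\<forall>i x. (\<lambda>t. iterated_partial xs f (x + t *\<^sub>R axis i 1)) differentiable (at 0))}"

text \<open>
  The derivative of multi-index \<open>\<alpha>\<close> differentiates \<open>\<alpha> i\<close> times in direction \<open>i\<close>, for each \<open>i\<close>.
  As the index type carries no order, some order of differentiation is picked by choice
  (one exists by the lemma below); on \<^const>\<open>C_infinity\<close>, the only place where
  it is used, the order is immaterial by the symmetry of mixed partial derivatives.
\<close>

definition multi_partial ::
    "('n \<Rightarrow> nat) \<Rightarrow> (real ^ 'n \<Rightarrow> complex) \<Rightarrow> real ^ 'n \<Rightarrow> complex" where
  "multi_partial \<alpha> f = iterated_partial (SOME xs. \<forall>i. count_list xs i = \<alpha> i) f"

lemma ex_list_of_multi_index:
  fixes \<alpha> :: "'n::finite \<Rightarrow> nat"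
  shows "\<exists>xs. \<forall>i. count_list xs i = \<alpha> i"
proof -
  obtain xs where xs: "mset xs = Abs_multiset \<alpha>"
    using ex_mset by blast
  have "count (mset xs) i = \<alpha> i" for i
    by (simp add: xs)
  then have "\<forall>i. count_list xs i = \<alpha> i"
    by (metis count_mset count_list_eq_length_filter)
  then show ?thesis by blast
qed

end

(*
  A function f in VMO is approximated by its mollification f_t(x) = int k_t(y - x) f(y) dy, where
  k_t is a smooth probability density supported in [0,t]^n and bounded by a constant times t^-n.

  On a cube q of side at most t, all values of f_t are within a constant times the oscillation of f
  at scale 2t from the average of f over a cube q* of side 2t containing q.  This bounds the mean
  oscillation of f - f_t over cubes of side at most t.  On a larger cube Q, the integral of
  |f - f_t| over Q is controlled by averaging over all cubes of side t that meet Q.  Hence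
  ||f - f_t||_BMO is at most a constant times the oscillation of f at scales up to 2t.

  Differentiating f_t only replaces k_t by a derivative of k_t, whose integral vanishes when the order
  is at least 1; subtracting an average of f then shows that these derivatives are bounded.  The same
  subtraction makes f_t and all its derivatives Lipschitz at distances up to 1, and comparing averages
  over dyadically growing cubes around two points gives logarithmic growth at large distances.
*)
theory Submission
  imports Defs "HOL-Computational_Algebra.Polynomial"
begin

section \<open>Smooth bump kernels\<close>

text \<open>With p = 1 this is exp (-1/s) extended by 0 to s <= 0, the standard smooth function that
  is flat at 0. Polynomial factors in 1/s make the class closed under differentiation.\<close>

definition flat_exp :: "real poly \<Rightarrow> real \<Rightarrow> real" where
  "flat_exp p s = (if s > 0 then poly p (1 / s) * exp (- (1 / s)) else 0)"

lemma poly_times_exp_minus_tendsto_0: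
  fixes p :: "real poly"
  shows "((\<lambda>x. poly p x * exp (- x)) \<longlongrightarrow> 0) at_top"
proof -
  have "((\<lambda>x. \<Sum>i\<le>degree p. coeff p i * (x ^ i / exp x)) \<longlongrightarrow> (\<Sum>i\<le>degree p. coeff p i * 0)) at_top"
    by (intro tendsto_sum tendsto_mult tendsto_const tendsto_power_div_exp_0)
  then show ?thesis
    by (simp add: poly_altdef sum_distrib_right exp_minus divide_inverse mult.assoc)
qed

text \<open>For s > 0 the chain rule produces the factor 1/s^2, which is the polynomial
  \<open>[:0, 0, 1:]\<close> in 1/s, and the derivative of the exponential contributes
  \<open>p\<close> while that of the polynomial contributes \<open>- pderiv p\<close>.\<close>

lemma flat_exp_has_derivative:
  "(flat_exp p has_real_derivative flat_exp ([:0, 0, 1:] * (p - pderiv p)) s) (at s)"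
proof (cases s "0::real" rule: linorder_cases)
  case less
  have "((\<lambda>_. 0) has_real_derivative flat_exp ([:0, 0, 1:] * (p - pderiv p)) s) (at s)"
    using less by (simp add: flat_exp_def)
  then show ?thesis
    by (rule has_field_derivative_transform_within_open[where S = "{..<0}"])
       (use less in \<open>auto simp: flat_exp_def\<close>)
next
  case greater
  have "((\<lambda>s. poly p (1 / s) * exp (- (1 / s))) has_real_derivative
      flat_exp ([:0, 0, 1:] * (p - pderiv p)) s) (at s)"
    using greater
    by (auto intro!: derivative_eq_intros poly_DERIV[THEN DERIV_chain2]
        simp: flat_exp_def algebra_simps power2_eq_square)
  then show ?thesis
    by (rule has_field_derivative_transform_within_open[where S = "{0<..}"])
       (use greater in \<open>auto simp: flat_exp_def\<close>)
next
  case equal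
  \<comment> \<open>The extra factor x turns into the division by y in the difference quotient at 0
    after the substitution x = 1/y.\<close>
  have "((\<lambda>x. poly ([:0, 1:] * p) x * exp (- x)) \<longlongrightarrow> 0) at_top"
    by (rule poly_times_exp_minus_tendsto_0)
  then have "((\<lambda>y. poly ([:0, 1:] * p) (inverse y) * exp (- inverse y)) \<longlongrightarrow> 0) (at_right 0)"
    by (rule filterlim_compose[OF _ filterlim_inverse_at_top_right])
  then have right: "((\<lambda>y. flat_exp p y / y) \<longlongrightarrow> 0) (at_right 0)"
    by (rule Lim_transform_eventually)
       (auto simp: eventually_at_right_less flat_exp_def field_simps
         intro!: eventually_mono[OF eventually_at_right_less])
  have left: "((\<lambda>y. flat_exp p y / y) \<longlongrightarrow> 0) (at_left 0)"
    by (rule tendsto_eventually)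
       (auto simp: flat_exp_def eventually_at_left_field intro!: exI[of _ "-1"])
  have "((\<lambda>y. flat_exp p y / y) \<longlongrightarrow> 0) (at 0)"
    using left right by (simp add: filterlim_split_at)
  then show ?thesis
    using equal by (simp add: has_field_derivative_iff flat_exp_def)
qed

text \<open>A family of functions supported in \<open>{0..1}\<close> that is closed under differentiation.\<close>

inductive_set bumps :: "(real \<Rightarrow> real) set" where
  product: "(\<lambda>s. flat_exp p s * flat_exp q (1 - s)) \<in> bumps"
| add: "f \<in> bumps \<Longrightarrow> g \<in> bumps \<Longrightarrow> (\<lambda>s. f s + g s) \<in> bumps"

lemma flat_exp_uminus: "flat_exp (- p) s = - flat_exp p s"
  by (simp add: flat_exp_def)

lemma bumps_has_derivative:
  "f \<in> bumps \<Longrightarrow> \<exists>g\<in>bumps. \<forall>s. (f has_real_derivative g s) (at s)"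
proof (induction rule: bumps.induct)
  case (product p q)
  define D where "D r = [:0, 0, 1:] * (r - pderiv r)" for r :: "real poly"
  \<comment> \<open>The inner derivative of \<open>1 - s\<close> contributes a minus sign. It is
    absorbed into the polynomial as \<open>- D q\<close>, so that both summands have the product
    form of the generators.\<close>
  let ?g = "\<lambda>s. flat_exp (D p) s * flat_exp q (1 - s) + flat_exp p s * flat_exp (- D q) (1 - s)"
  have "((\<lambda>s. flat_exp p s * flat_exp q (1 - s)) has_real_derivative ?g s) (at s)" for s
    unfolding D_def
    by (rule derivative_eq_intros flat_exp_has_derivative refl
        DERIV_chain2[where f = "flat_exp q", OF flat_exp_has_derivative])+
       (simp add: flat_exp_uminus del: mult_pCons_left)
  moreover have "?g \<in> bumps"
    by (intro bumps.intros)
  ultimately show ?case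
    by (intro bexI[of _ ?g]) auto
next
  case (add f g)
  then obtain f' g' where "f' \<in> bumps" "\<forall>s. (f has_real_derivative f' s) (at s)"
    and "g' \<in> bumps" "\<forall>s. (g has_real_derivative g' s) (at s)"
    by blast
  then show ?case
    by (intro bexI[of _ "\<lambda>s. f' s + g' s"]) (auto intro: DERIV_add bumps.add)
qed

text \<open>For m = 0 this is exp (-1/s - 1/(1 - s)) on (0,1), extended by 0.\<close>

definition bump :: "nat \<Rightarrow> real \<Rightarrow> real" where
  "bump m = (deriv ^^ m) (\<lambda>s. flat_exp 1 s * flat_exp 1 (1 - s))"

lemma bump_0: "bump 0 s = flat_exp 1 s * flat_exp 1 (1 - s)"
  by (simp add: bump_def)

lemma deriv_bumps:
  assumes "f \<in> bumps"
  shows "deriv f \<in> bumps" and "(f has_real_derivative deriv f s) (at s)"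
proof -
  obtain g where g: "g \<in> bumps" "\<forall>s. (f has_real_derivative g s) (at s)"
    using bumps_has_derivative[OF assms] by blast
  then have "deriv f = g"
    by (auto intro: DERIV_imp_deriv)
  with g show "deriv f \<in> bumps" "(f has_real_derivative deriv f s) (at s)"
    by auto
qed

lemma bump_in_bumps: "bump m \<in> bumps"
  by (induction m) (auto simp: bump_def intro: deriv_bumps bumps.product)

lemma bump_has_derivative: "(bump m has_real_derivative bump (Suc m) s) (at s)"
  using deriv_bumps(2)[OF bump_in_bumps[of m]] by (simp add: bump_def)

lemma bumps_support: "f \<in> bumps \<Longrightarrow> s \<notin> {0..1} \<Longrightarrow> f s = 0"
  by (induction rule: bumps.induct) (auto simp: flat_exp_def)

lemma bump_support: "s \<notin> {0..1} \<Longrightarrow> bump m s = 0"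
  using bump_in_bumps bumps_support by blast

lemma bump_bounded: obtains B where "0 \<le> B" "\<And>s. \<bar>bump m s\<bar> \<le> B"
proof -
  have "continuous_on {0..1} (bump m)"
    by (meson DERIV_isCont bump_has_derivative continuous_at_imp_continuous_on)
  then have "bounded (bump m ` {0..1})"
    by (intro compact_imp_bounded compact_continuous_image) auto
  then have "\<exists>B. \<forall>s\<in>{0..1}. \<bar>bump m s\<bar> \<le> B"
    by (simp add: bounded_iff)
  then obtain B where B: "\<And>s. s \<in> {0..1} \<Longrightarrow> \<bar>bump m s\<bar> \<le> B"
    by blast
  have "\<bar>bump m s\<bar> \<le> max 0 B" for s
    using B[of s] bump_support[of s m] by (cases "s \<in> {0..1}") (auto simp: max_def)
  then show thesis
    using that[of "max 0 B"] by simp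
qed

lemma bump_lipschitz: obtains L where "0 \<le> L" "\<And>s t. \<bar>bump m s - bump m t\<bar> \<le> L * \<bar>s - t\<bar>"
proof -
  obtain L where "0 \<le> L" "\<And>s. \<bar>bump (Suc m) s\<bar> \<le> L"
    using bump_bounded by blast
  then show thesis
    using that[of L] field_differentiable_bound[of UNIV "bump m" "bump (Suc m)" L]
    by (simp add: bump_has_derivative)
qed

lemma bump_0_nonneg: "0 \<le> bump 0 s"
  and bump_0_le_1: "bump 0 s \<le> 1"
  by (auto simp: bump_0 flat_exp_def mult_le_one)

text \<open>On the middle half of the unit interval both 1/s and 1/(1 - s) are at most 4. This later
  bounds the integral of the kernel from below, and hence its normalising constant from
  above.\<close>

lemma bump_0_lower:
  assumes "s \<in> {1/4..3/4}"
  shows "exp (- 8) \<le> bump 0 s"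
proof -
  have "exp (- 4) \<le> exp (- (1 / r))" if "1/4 \<le> r" for r :: real
    using that by (simp add: field_simps)
  then have "exp (- 4) * exp (- 4) \<le> exp (- (1 / s)) * exp (- (1 / (1 - s)))"
    using assms by (intro mult_mono) auto
  then show ?thesis
    using assms by (simp add: bump_0 flat_exp_def flip: exp_add)
qed

section \<open>Product kernels on R^n and their uniform estimates\<close>

text \<open>The entry \<open>m i\<close> is the order of the derivative already taken in direction
  i, and \<open>c\<close> collects the constants. Thus every partial derivative of a kernel is a
  kernel with the same \<open>t\<close>.\<close>

definition bump_kernel :: "real \<Rightarrow> ('n \<Rightarrow> nat) \<Rightarrow> real \<Rightarrow> real ^ 'n \<Rightarrow> real" where
  "bump_kernel c m t x = c * (\<Prod>i\<in>UNIV. bump (m i) (x $ i / t))"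

lemma bump_kernel_support:
  assumes "0 < t" "bump_kernel c m t x \<noteq> 0"
  shows "x \<in> cube 0 t"
proof -
  have "bump (m i) (x $ i / t) \<noteq> 0" for i
    using assms by (auto simp: bump_kernel_def)
  then have "x $ i / t \<in> {0..1}" for i
    using bump_support by blast
  then show ?thesis
    using assms by (auto simp: cube_def mem_box_cart field_simps)
qed

lemma bump_kernel_bounded: obtains B where "0 \<le> B" "\<And>x. \<bar>bump_kernel c m t x\<bar> \<le> B"
proof -
  have "\<forall>i. \<exists>B. \<forall>s. \<bar>bump (m i) s\<bar> \<le> B"
    by (metis bump_bounded)
  then obtain B where B: "\<And>i s. \<bar>bump (m i) s\<bar> \<le> B i"
    by metis
  have "\<bar>bump_kernel c m t x\<bar> \<le> \<bar>c\<bar> * (\<Prod>i\<in>UNIV. B i)" for x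
    by (auto simp: bump_kernel_def abs_mult abs_prod intro!: mult_left_mono prod_mono B)
  moreover from this have "0 \<le> \<bar>c\<bar> * (\<Prod>i\<in>UNIV. B i)"
    using abs_ge_zero order_trans by blast
  ultimately show thesis
    using that by blast
qed

text \<open>A product of factors of absolute value at most 1 varies by at most the sum of the
  variations of its factors. Each factor is therefore first divided by a bound \<open>A i\<close>,
  and the product of these bounds goes into the constant.\<close>

lemma bump_kernel_lipschitz:
  assumes "0 < t"
  obtains L where "0 \<le> L" "\<And>x y. \<bar>bump_kernel c m t x - bump_kernel c m t y\<bar> \<le> L * norm (x - y)"
proof -
  have "\<forall>i. \<exists>B\<ge>0. \<forall>s. \<bar>bump (m i) s\<bar> \<le> B" "\<forall>i. \<exists>L\<ge>0. \<forall>s r. \<bar>bump (m i) s - bump (m i) r\<bar> \<le> L * \<bar>s - r\<bar>"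
    by (metis bump_bounded) (metis bump_lipschitz)
  then obtain B L where B: "\<And>i s. \<bar>bump (m i) s\<bar> \<le> B i" "\<And>i. 0 \<le> B i"
    and L: "\<And>i s r. \<bar>bump (m i) s - bump (m i) r\<bar> \<le> L i * \<bar>s - r\<bar>" "\<And>i. 0 \<le> L i"
    by metis
  \<comment> \<open>Adding 1 keeps the divisor positive even if the bound \<open>B i\<close> is
    0.\<close>
  define A where "A i = B i + 1" for i
  have A: "A i > 0" "\<bar>bump (m i) s / A i\<bar> \<le> 1" for i s
    using B[of i] by (auto simp: A_def abs_le_iff field_simps add_pos_nonneg intro: order_trans)
       (smt (verit))+
  define C where "C = \<bar>c\<bar> * (\<Prod>i\<in>UNIV. A i)"
  have C: "C \<ge> 0"
    using A(1) by (auto simp: C_def less_imp_le intro!: mult_nonneg_nonneg prod_nonneg)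
  have "\<bar>bump_kernel c m t x - bump_kernel c m t y\<bar> \<le> (C * (\<Sum>i\<in>UNIV. L i / (A i * t))) * norm (x - y)" for x y
  proof -
    let ?z = "\<lambda>x i. bump (m i) (x $ i / t) / A i"
    have *: "bump_kernel c m t x = c * ((\<Prod>i\<in>UNIV. A i) * (\<Prod>i\<in>UNIV. ?z x i))" for x
    proof -
      have "A i \<noteq> 0" for i
        using A(1)[of i] by simp
      then show ?thesis
        by (simp add: bump_kernel_def flip: prod.distrib)
    qed
    have "\<bar>bump_kernel c m t x - bump_kernel c m t y\<bar> = C * \<bar>(\<Prod>i\<in>UNIV. ?z x i) - (\<Prod>i\<in>UNIV. ?z y i)\<bar>"
      unfolding * C_def using A(1)
      by (simp add: abs_mult abs_prod abs_of_pos flip: right_diff_distrib)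
    also have "\<dots> \<le> C * (\<Sum>i\<in>UNIV. \<bar>?z x i - ?z y i\<bar>)"
      using norm_prod_diff[of UNIV "?z x" "?z y"] A(2) C by (auto intro: mult_left_mono)
    also have "\<dots> \<le> C * (\<Sum>i\<in>UNIV. L i / (A i * t) * norm (x - y))"
    proof (intro mult_left_mono sum_mono C)
      fix i
      have "\<bar>?z x i - ?z y i\<bar> = \<bar>bump (m i) (x $ i / t) - bump (m i) (y $ i / t)\<bar> / A i"
        using A(1)[of i] by (simp add: abs_divide flip: diff_divide_distrib)
      also have "\<dots> \<le> (L i * \<bar>x $ i / t - y $ i / t\<bar>) / A i"
        using A(1)[of i] L(1)[of i] by (intro divide_right_mono) auto
      also have "\<dots> = L i / (A i * t) * \<bar>(x - y) $ i\<bar>"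
        using assms by (simp add: abs_divide flip: diff_divide_distrib)
      also have "\<dots> \<le> L i / (A i * t) * norm (x - y)"
        using A(1)[of i] L(2)[of i] assms by (intro mult_left_mono component_le_norm_cart) auto
      finally show "\<bar>?z x i - ?z y i\<bar> \<le> L i / (A i * t) * norm (x - y)" .
    qed
    finally show ?thesis
      by (simp add: sum_distrib_right mult.assoc)
  qed
  moreover have "0 \<le> C * (\<Sum>i\<in>UNIV. L i / (A i * t))"
    using C A(1) L(2) assms by (intro mult_nonneg_nonneg sum_nonneg divide_nonneg_pos) auto
  ultimately show thesis
    using that by blast
qed

lemma bump_kernel_continuous:
  assumes "0 < t"
  shows "continuous_on UNIV (bump_kernel c m t)"
proof -
  obtain L where "0 \<le> L" "\<And>x y. \<bar>bump_kernel c m t x - bump_kernel c m t y\<bar> \<le> L * norm (x - y)"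
    using bump_kernel_lipschitz[OF assms] by blast
  then have "L-lipschitz_on UNIV (bump_kernel c m t)"
    by (intro lipschitz_onI) (auto simp: dist_norm)
  then show ?thesis
    by (rule lipschitz_on_continuous_on)
qed

lemma bump_kernel_has_derivative:
  assumes "0 < t"
  shows "((\<lambda>s. bump_kernel c m t (x + s *\<^sub>R axis i 1)) has_real_derivative
    bump_kernel (c / t) (m(i := Suc (m i))) t (x + s *\<^sub>R axis i 1)) (at s)"
proof -
  have split: "bump_kernel c m t y = c * (\<Prod>j\<in>UNIV - {i}. bump (m j) (y $ j / t)) * bump (m i) (y $ i / t)"
    for c m and y :: "real ^ 'a"
    by (simp add: bump_kernel_def prod.remove[of UNIV i])
  have fixed: "(\<Prod>j\<in>UNIV - {i}. bump (m j) ((x + s *\<^sub>R axis i 1) $ j / t)) = (\<Prod>j\<in>UNIV - {i}. bump (m j) (x $ j / t))" for s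
    by (intro prod.cong) (auto simp: axis_def)
  have fixed': "(\<Prod>j\<in>UNIV - {i}. bump ((m(i := Suc (m i))) j) ((x + s *\<^sub>R axis i 1) $ j / t)) = (\<Prod>j\<in>UNIV - {i}. bump (m j) (x $ j / t))" for s
    by (intro prod.cong) (auto simp: axis_def)
  show ?thesis
    unfolding split fixed fixed'
    by (rule derivative_eq_intros DERIV_chain2[where f = "bump (m i)", OF bump_has_derivative] refl)+
      (use assms in \<open>auto simp: axis_def intro!: derivative_eq_intros\<close>)
qed

text \<open>The derivative of the remainder is a difference of values of the derivative kernel,
  which is Lipschitz, so it is at most \<open>L * \<bar>s\<bar>\<close> on the segment from 0 to s.
  Uniformity in \<open>x\<close> permits differentiation under the integral by a direct error
  bound.\<close>

lemma bump_kernel_taylor: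
  assumes "0 < t"
  obtains L where "0 \<le> L" "\<And>x s. \<bar>bump_kernel c m t (x + s *\<^sub>R axis i 1) - bump_kernel c m t x
     - s * bump_kernel (c / t) (m(i := Suc (m i))) t x\<bar> \<le> L * s\<^sup>2"
proof -
  let ?k = "bump_kernel c m t" and ?k' = "bump_kernel (c / t) (m(i := Suc (m i))) t"
  obtain L where L: "0 \<le> L" "\<And>x y. \<bar>?k' x - ?k' y\<bar> \<le> L * norm (x - y)"
    using bump_kernel_lipschitz[OF assms] by blast
  have "\<bar>?k (x + s *\<^sub>R axis i 1) - ?k x - s * ?k' x\<bar> \<le> L * s\<^sup>2" for x s
  proof -
    let ?g = "\<lambda>r. ?k (x + r *\<^sub>R axis i 1) - r * ?k' x"
    let ?g' = "\<lambda>r. ?k' (x + r *\<^sub>R axis i 1) - ?k' x"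
    have "norm (?g s - ?g 0) \<le> (L * \<bar>s\<bar>) * norm (s - 0)"
    proof (rule field_differentiable_bound)
      show "convex (closed_segment 0 s)" by simp
      show "(?g has_real_derivative ?g' r) (at r within closed_segment 0 s)" for r
        by (rule has_field_derivative_at_within)
           (auto intro!: derivative_eq_intros bump_kernel_has_derivative[OF assms])
      show "norm (?g' r) \<le> L * \<bar>s\<bar>" if "r \<in> closed_segment 0 s" for r
      proof -
        have "norm (?g' r) \<le> L * \<bar>r\<bar>"
          using L(2)[of "x + r *\<^sub>R axis i 1" x] by simp
        also have "\<dots> \<le> L * \<bar>s\<bar>"
          using that L(1) by (intro mult_left_mono) (auto simp: closed_segment_eq_real_ivl split: if_splits)
        finally show ?thesis .
      qed
    qed auto
    then show ?thesis
      by (simp add: power2_eq_square algebra_simps abs_mult_self_eq)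
  qed
  with L(1) show thesis
    using that by blast
qed

section \<open>Averages and oscillation over cubes\<close>

lemma mem_cube: "x \<in> cube a l \<longleftrightarrow> (\<forall>i. a $ i \<le> x $ i \<and> x $ i \<le> a $ i + l)"
  by (simp add: cube_def mem_box_cart)

lemma compact_cube [simp]: "compact (cube a l)"
  by (simp add: cube_def)

lemma borel_cube: "cube a l \<in> sets borel"
  by (simp add: cube_def)

lemma sets_cube [measurable, simp]: "cube a l \<in> sets lebesgue"
  by (simp add: cube_def)

lemma measure_cube:
  fixes a :: "real ^ 'n"
  assumes "0 \<le> l"
  shows "measure lebesgue (cube a l) = l ^ CARD('n)"
proof -
  have "cbox a (a + vec l) \<noteq> {}"
    using assms by (auto simp: interval_ne_empty_cart)
  then show ?thesis
    by (simp add: cube_def content_cbox_cart)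
qed

lemma emeasure_cube_finite: "emeasure lebesgue (cube a l) < \<infinity>"
  using emeasure_bounded_finite[OF bounded_cbox[of a "a + vec l"]] by (simp add: cube_def)

lemma set_integrable_cube: "f \<in> L1_loc \<Longrightarrow> set_integrable lebesgue (cube a l) f"
  by (auto simp: L1_loc_def)

lemma set_integrable_const_cube [simp]:
  "set_integrable lebesgue (cube a l) (\<lambda>_. c :: 'b :: {banach, second_countable_topology})"
  using emeasure_cube_finite[of a l] by (auto simp: set_integrable_def)

lemma set_integral_const_cube:
  fixes a :: "real ^ 'n" and c :: "'b :: {banach, second_countable_topology}"
  assumes "0 \<le> l"
  shows "(LINT x:cube a l|lebesgue. c) = l ^ CARD('n) *\<^sub>R c"
  using emeasure_cube_finite[of a l] assms
  by (simp add: set_lebesgue_integral_def measure_cube)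

lemma L1_loc_const [simp]: "(\<lambda>_. c) \<in> L1_loc"
  unfolding L1_loc_def set_integrable_def
proof (intro CollectI allI impI)
  fix K :: "(real ^ 'a) set"
  assume "compact K"
  then have "K \<in> sets lebesgue" "emeasure lebesgue K < \<infinity>"
    using lmeasurable_compact[of K] by (auto simp: fmeasurable_def)
  then show "integrable lebesgue (\<lambda>x. indicator K x *\<^sub>R c)"
    by auto
qed

lemma set_integrable_norm_diff_const:
  assumes "f \<in> L1_loc"
  shows "set_integrable lebesgue (cube a l) (\<lambda>x. norm (f x - c))"
  by (intro set_integrable_norm set_integral_diff set_integrable_cube assms) simp

lemma set_integral_nonneg_mono_set:
  fixes g :: "'a \<Rightarrow> real"
  assumes "set_integrable M B g" "A \<in> sets M" "A \<subseteq> B" "\<And>x. 0 \<le> g x"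
  shows "(LINT x:A|M. g x) \<le> (LINT x:B|M. g x)"
  unfolding set_lebesgue_integral_def
proof (rule integral_mono)
  show "integrable M (\<lambda>x. indicator A x *\<^sub>R g x)"
    using set_integrable_subset[OF assms(1-3)] by (simp add: set_integrable_def)
  show "integrable M (\<lambda>x. indicator B x *\<^sub>R g x)"
    using assms(1) by (simp add: set_integrable_def)
  show "indicator A x *\<^sub>R g x \<le> indicator B x *\<^sub>R g x" for x
    using assms(3,4) by (auto simp: indicator_def)
qed

lemma set_integral_nonneg:
  fixes g :: "'a \<Rightarrow> real"
  assumes "\<And>x. 0 \<le> g x"
  shows "0 \<le> (LINT x:A|M. g x)"
  unfolding set_lebesgue_integral_def using assms by (intro Bochner_Integration.integral_nonneg) auto

lemma mean_oscillation_nonneg: "0 \<le> mean_oscillation Q f"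
  by (simp add: mean_oscillation_def set_integral_nonneg)

lemma set_integral_norm_diff_average:
  fixes f :: "real ^ 'n \<Rightarrow> complex"
  assumes "0 < l"
  shows "(LINT x:cube a l|lebesgue. norm (f x - average (cube a l) f)) = l ^ CARD('n) * mean_oscillation (cube a l) f"
  using assms by (simp add: mean_oscillation_def measure_cube)

lemma norm_average_diff_le:
  fixes f :: "real ^ 'n \<Rightarrow> complex"
  assumes "f \<in> L1_loc" "0 < l"
  shows "norm (average (cube a l) f - c) \<le> (LINT x:cube a l|lebesgue. norm (f x - c)) / l ^ CARD('n)"
proof -
  let ?Q = "cube a l"
  have "(LINT x:?Q|lebesgue. f x - c) = (LINT x:?Q|lebesgue. f x) - l ^ CARD('n) *\<^sub>R c"
    using assms by (subst set_integral_diff) (simp_all add: set_integrable_cube set_integral_const_cube)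
  then have "average ?Q f - c = (1 / l ^ CARD('n)) *\<^sub>R (LINT x:?Q|lebesgue. f x - c)"
    using assms by (simp add: average_def measure_cube scaleR_diff_right)
  then have "norm (average ?Q f - c) = norm (LINT x:?Q|lebesgue. f x - c) / l ^ CARD('n)"
    using assms by simp
  also have "\<dots> \<le> (LINT x:?Q|lebesgue. norm (f x - c)) / l ^ CARD('n)"
    using assms
    by (intro divide_right_mono set_integral_norm_bound set_integral_diff set_integrable_cube) auto
  finally show ?thesis .
qed

text \<open>The average lies within the mean of \<open>norm (f x - c)\<close> from \<open>c\<close>,
  so replacing the average by any constant costs a factor 2.\<close>

lemma mean_oscillation_le:
  fixes f :: "real ^ 'n \<Rightarrow> complex"
  assumes "f \<in> L1_loc" "0 < l"
  shows "mean_oscillation (cube a l) f \<le> 2 * (LINT x:cube a l|lebesgue. norm (f x - c)) / l ^ CARD('n)"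
proof -
  let ?Q = "cube a l" and ?I = "LINT x:cube a l|lebesgue. norm (f x - c)"
  have "(LINT x:?Q|lebesgue. norm (f x - average ?Q f))
      \<le> (LINT x:?Q|lebesgue. norm (f x - c) + norm (average ?Q f - c))"
    using assms norm_triangle_ineq4[of "f _ - c" "average ?Q f - c"]
    by (intro set_integral_mono set_integral_add set_integrable_norm_diff_const) auto
  also have "\<dots> = ?I + l ^ CARD('n) * norm (average ?Q f - c)"
    using assms
    by (subst set_integral_add) (simp_all add: set_integrable_norm_diff_const set_integral_const_cube)
  also have "\<dots> \<le> ?I + l ^ CARD('n) * (?I / l ^ CARD('n))"
    using assms by (intro add_left_mono mult_left_mono norm_average_diff_le) auto
  also have "\<dots> = 2 * ?I"
    using assms by simp
  finally show ?thesis
    using assms by (simp add: mean_oscillation_def measure_cube divide_right_mono)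
qed

lemma mean_oscillation_diff_le:
  fixes f g :: "real ^ 'n \<Rightarrow> complex"
  assumes "f \<in> L1_loc" "g \<in> L1_loc" "0 < l"
  shows "mean_oscillation (cube a l) (\<lambda>x. f x - g x)
    \<le> mean_oscillation (cube a l) f + mean_oscillation (cube a l) g"
proof -
  let ?Q = "cube a l"
  have avg: "average ?Q (\<lambda>x. f x - g x) = average ?Q f - average ?Q g"
    using assms by (simp add: average_def set_integral_diff set_integrable_cube scaleR_diff_right)
  have eq: "(f x - g x) - average ?Q (\<lambda>x. f x - g x) = (f x - average ?Q f) - (g x - average ?Q g)" for x
    by (simp add: avg)
  have "(LINT x:?Q|lebesgue. norm ((f x - g x) - average ?Q (\<lambda>x. f x - g x)))
      \<le> (LINT x:?Q|lebesgue. norm (f x - average ?Q f) + norm (g x - average ?Q g))"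
    unfolding eq using assms
    by (intro set_integral_mono set_integral_add set_integrable_norm_diff_const norm_triangle_ineq4
        set_integrable_norm set_integral_diff set_integrable_cube) auto
  also have "\<dots> = (LINT x:?Q|lebesgue. norm (f x - average ?Q f)) + (LINT x:?Q|lebesgue. norm (g x - average ?Q g))"
    using assms by (intro set_integral_add set_integrable_norm_diff_const)
  finally have "(LINT x:?Q|lebesgue. norm ((f x - g x) - average ?Q (\<lambda>x. f x - g x))) / l ^ CARD('n)
      \<le> ((LINT x:?Q|lebesgue. norm (f x - average ?Q f)) + (LINT x:?Q|lebesgue. norm (g x - average ?Q g))) / l ^ CARD('n)"
    using assms by (intro divide_right_mono) auto
  then show ?thesis
    using assms by (simp add: mean_oscillation_def measure_cube add_divide_distrib)
qed

text \<open>Enlarging the domain of integration from the small cube to the large one costs the ratio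
  of the volumes.\<close>

lemma average_subcube_diff_le:
  fixes f :: "real ^ 'n \<Rightarrow> complex"
  assumes "f \<in> L1_loc" "0 < r" "0 < l" "cube b r \<subseteq> cube a l"
  shows "norm (average (cube b r) f - average (cube a l) f) \<le> (l / r) ^ CARD('n) * mean_oscillation (cube a l) f"
proof -
  let ?c = "average (cube a l) f"
  have "norm (average (cube b r) f - ?c) \<le> (LINT x:cube b r|lebesgue. norm (f x - ?c)) / r ^ CARD('n)"
    using assms by (intro norm_average_diff_le)
  also have "\<dots> \<le> (LINT x:cube a l|lebesgue. norm (f x - ?c)) / r ^ CARD('n)"
    using assms by (intro divide_right_mono set_integral_nonneg_mono_set set_integrable_norm_diff_const) auto
  also have "\<dots> = (l / r) ^ CARD('n) * mean_oscillation (cube a l) f"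
    using assms by (simp add: set_integral_norm_diff_average power_divide)
  finally show ?thesis .
qed

section \<open>Integrals against bounded weights of compact support\<close>

lemma weighted_integral_bound:
  fixes f :: "real ^ 'n \<Rightarrow> complex" and w :: "real ^ 'n \<Rightarrow> real"
  assumes [measurable]: "w \<in> borel_measurable lebesgue" and "Q \<in> sets lebesgue"
    and B: "\<And>y. \<bar>w y\<bar> \<le> B" and supp: "\<And>y. y \<notin> Q \<Longrightarrow> w y = 0"
    and f: "set_integrable lebesgue Q f"
  shows "integrable lebesgue (\<lambda>y. w y *\<^sub>R f y)"
    and "norm (LINT y|lebesgue. w y *\<^sub>R f y) \<le> B * (LINT y:Q|lebesgue. norm (f y))"
proof -
  \<comment> \<open>Measurability of \<open>f\<close> is given on \<open>Q\<close> alone, so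
    \<open>f\<close> is replaced by its cut-off; the two agree wherever \<open>w\<close> is
    nonzero.\<close>
  let ?F = "\<lambda>y. indicator Q y *\<^sub>R f y"
  have F: "integrable lebesgue ?F"
    using f by (simp add: set_integrable_def)
  then have [measurable]: "?F \<in> borel_measurable lebesgue"
    by (rule borel_measurable_integrable)
  have eq: "w y *\<^sub>R f y = w y *\<^sub>R ?F y" for y
    using supp[of y] by (auto simp: indicator_def)
  have "0 \<le> B"
    using B order_trans abs_ge_zero by blast
  then have le: "norm (w y *\<^sub>R ?F y) \<le> norm (B *\<^sub>R ?F y)" for y
    using B[of y] by (auto simp: indicator_def intro!: mult_right_mono)
  show int: "integrable lebesgue (\<lambda>y. w y *\<^sub>R f y)"
    unfolding eq
  proof (rule Bochner_Integration.integrable_bound)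
    show "integrable lebesgue (\<lambda>y. B *\<^sub>R ?F y)"
      by (rule integrable_scaleR_right) (rule F)
    show "(\<lambda>y. w y *\<^sub>R ?F y) \<in> borel_measurable lebesgue"
      by (rule borel_measurable_scaleR) fact+
  qed (intro AE_I2 le)
  have "norm (LINT y|lebesgue. w y *\<^sub>R f y) \<le> (LINT y|lebesgue. B * (indicator Q y *\<^sub>R norm (f y)))"
  proof (rule Bochner_Integration.integral_norm_bound_integral[OF int])
    show "integrable lebesgue (\<lambda>y. B * (indicator Q y *\<^sub>R norm (f y)))"
      using integrable_norm[OF F] by (intro integrable_mult_right) simp
    show "norm (w y *\<^sub>R f y) \<le> B * (indicator Q y *\<^sub>R norm (f y))" for y
      using B[of y] supp[of y] by (auto simp: indicator_def intro: mult_right_mono)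
  qed
  then show "norm (LINT y|lebesgue. w y *\<^sub>R f y) \<le> B * (LINT y:Q|lebesgue. norm (f y))"
    by (simp add: set_lebesgue_integral_def)
qed

text \<open>Since \<open>w\<close> is integrated against \<open>f\<close> minus its average, the
  size of \<open>f\<close> is replaced by its oscillation. For a weight of integral 0 the average
  disappears altogether; all later bounds on mollifications come from this estimate.\<close>

lemma weighted_integral_oscillation:
  fixes f :: "real ^ 'n \<Rightarrow> complex" and w :: "real ^ 'n \<Rightarrow> real"
  assumes w: "w \<in> borel_measurable lebesgue" "\<And>y. \<bar>w y\<bar> \<le> B" "\<And>y. y \<notin> cube a l \<Longrightarrow> w y = 0"
    and f: "f \<in> L1_loc" and l: "0 < l"
  shows "norm ((LINT y|lebesgue. w y *\<^sub>R f y) - (LINT y|lebesgue. w y) *\<^sub>R average (cube a l) f)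
    \<le> B * (l ^ CARD('n) * mean_oscillation (cube a l) f)"
proof -
  let ?c = "average (cube a l) f"
  note bound = weighted_integral_bound[OF w(1) sets_cube w(2,3)]
  have 1: "integrable lebesgue (\<lambda>y. w y *\<^sub>R f y)"
    by (rule bound) (use f in \<open>auto intro: set_integrable_cube\<close>)
  have 2: "integrable lebesgue (\<lambda>y. w y *\<^sub>R ?c)"
    by (rule bound) auto
  \<comment> \<open>The bound for complex-valued functions is applied to the constant 1; taking real
    parts gives integrability of the weight itself.\<close>
  have "integrable lebesgue (\<lambda>y. w y *\<^sub>R (1::complex))"
    by (rule bound) auto
  then have "integrable lebesgue w"
    using integrable_Re by fastforce
  then have "(LINT y|lebesgue. w y) *\<^sub>R ?c = (LINT y|lebesgue. w y *\<^sub>R ?c)"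
    by simp
  then have "(LINT y|lebesgue. w y *\<^sub>R f y) - (LINT y|lebesgue. w y) *\<^sub>R ?c = (LINT y|lebesgue. w y *\<^sub>R (f y - ?c))"
    using 1 2 by (simp add: scaleR_diff_right)
  also have "norm \<dots> \<le> B * (LINT y:cube a l|lebesgue. norm (f y - ?c))"
    by (rule bound) (use f in \<open>auto intro: set_integral_diff set_integrable_cube\<close>)
  finally show ?thesis
    using l by (simp add: set_integral_norm_diff_average)
qed

section \<open>Mollification of functions of bounded oscillation\<close>

text \<open>This is the convolution of \<open>f\<close> with the reflected kernel. With this
  orientation a bump kernel sees \<open>f\<close> on the cube with lower corner
  \<open>x\<close>.\<close>

definition smear :: "(real ^ 'n \<Rightarrow> real) \<Rightarrow> (real ^ 'n \<Rightarrow> complex) \<Rightarrow> real ^ 'n \<Rightarrow> complex" where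
  "smear k f x = (LINT y|lebesgue. k (y - x) *\<^sub>R f y)"

lemma borel_measurable_lebesgue_continuous:
  fixes k :: "real ^ 'n \<Rightarrow> 'b :: topological_space"
  assumes "continuous_on UNIV k"
  shows "k \<in> borel_measurable lebesgue"
  using assms by (auto intro!: measurable_completion borel_measurable_continuous_onI)

lemma bump_kernel_shift_support:
  assumes "0 < t" "y \<notin> cube x t"
  shows "bump_kernel c m t (y - x) = 0"
  using bump_kernel_support[OF assms(1), of c m "y - x"] assms(2) 
  by (fastforce simp: mem_cube algebra_simps)

lemma bump_kernel_shift_measurable:
  assumes "0 < t"
  shows "(\<lambda>y. bump_kernel c m t (y - x)) \<in> borel_measurable lebesgue"
  by (intro borel_measurable_lebesgue_continuous
      continuous_on_compose2[OF bump_kernel_continuous[OF assms]] continuous_intros) auto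

lemma integrable_smear:
  assumes "0 < t" "f \<in> L1_loc"
  shows "integrable lebesgue (\<lambda>y. bump_kernel c m t (y - x) *\<^sub>R f y)"
proof -
  obtain B where "\<And>x. \<bar>bump_kernel c m t x\<bar> \<le> B"
    using bump_kernel_bounded by blast
  then show ?thesis
    using assms
    by (intro weighted_integral_bound(1)[where Q = "cube x t" and B = B])
      (auto intro: bump_kernel_shift_measurable bump_kernel_shift_support set_integrable_cube)
qed

lemma integrable_bump_kernel_shift:
  assumes "0 < t"
  shows "integrable lebesgue (\<lambda>y. bump_kernel c m t (y - x))"
  using integrable_Re[OF integrable_smear[OF assms L1_loc_const[of 1], of c m x]] by simp

lemma integral_bump_kernel_shift:
  assumes "0 < t"
  shows "(LINT y|lebesgue. bump_kernel c m t (y - x)) = (LINT y|lebesgue. bump_kernel c m t y)"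
proof -
  let ?k = "bump_kernel c m t"
  have [measurable]: "?k \<in> borel_measurable borel"
    using bump_kernel_continuous[OF assms] by (rule borel_measurable_continuous_onI)
  have "(LINT y|lborel. ?k y) = (LINT y|distr lborel borel ((+) (- x)). ?k y)"
    by (simp add: lborel_distr_plus)
  also have "\<dots> = (LINT y|lborel. ?k (y - x))"
    by (subst integral_distr) simp_all
  finally show ?thesis
    by (subst (1 2) integral_completion) simp_all
qed

lemma smear_const:
  assumes "0 < t"
  shows "smear (bump_kernel c m t) (\<lambda>_. a) x = (LINT y|lebesgue. bump_kernel c m t y) *\<^sub>R a"
  using integrable_bump_kernel_shift[OF assms, of c m x] assms
  by (simp add: smear_def integral_bump_kernel_shift)

section \<open>Local regularity and derivatives of mollifications\<close>

text \<open>The difference of two translates of the kernel has integral 0 and is at most the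
  Lipschitz constant times \<open>norm (a - b)\<close>. Thus only the oscillation of
  \<open>f\<close> over a cube containing both supports enters.\<close>

lemma smear_diff_bound:
  fixes f :: "real ^ 'n \<Rightarrow> complex"
  assumes t: "0 < t" and f: "f \<in> L1_loc"
    and osc: "\<And>a l. 0 < l \<Longrightarrow> mean_oscillation (cube a l) f \<le> \<beta>"
  obtains C where "0 \<le> C"
    "\<And>a b. norm (a - b) \<le> 1 \<Longrightarrow> norm (smear (bump_kernel c m t) f a - smear (bump_kernel c m t) f b) \<le> C * norm (a - b)"
proof -
  let ?k = "bump_kernel c m t"
  obtain L where L: "0 \<le> L" "\<And>x y. \<bar>?k x - ?k y\<bar> \<le> L * norm (x - y)"
    using bump_kernel_lipschitz[OF t] by blast
  have "norm (smear ?k f a - smear ?k f b) \<le> (L * ((t + 2) ^ CARD('n) * \<beta>)) * norm (a - b)"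
    if ab: "norm (a - b) \<le> 1" for a b
  proof -
    let ?w = "\<lambda>y. ?k (y - a) - ?k (y - b)"
    \<comment> \<open>The coordinates of \<open>a\<close> and \<open>b\<close> differ by at most 1,
      so a margin of 1 on each side of \<open>cube a t\<close> also covers
      \<open>cube b t\<close>.\<close>
    let ?Q = "cube (a - vec 1) (t + 2)"
    have comp: "\<bar>a $ i - b $ i\<bar> \<le> 1" for i
      using component_le_norm_cart[of "a - b" i] ab by simp
    have near: "y \<in> ?Q" if "y \<in> cube a t \<or> y \<in> cube b t" for y
      unfolding mem_cube
    proof
      fix i
      show "(a - vec 1) $ i \<le> y $ i \<and> y $ i \<le> (a - vec 1) $ i + (t + 2)"
        using that comp[of i] unfolding mem_cube abs_le_iff by (auto dest!: spec[of _ i])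
    qed
    have "norm ((LINT y|lebesgue. ?w y *\<^sub>R f y) - (LINT y|lebesgue. ?w y) *\<^sub>R average ?Q f)
      \<le> (L * norm (a - b)) * ((t + 2) ^ CARD('n) * mean_oscillation ?Q f)"
    proof (rule weighted_integral_oscillation)
      show "\<bar>?w y\<bar> \<le> L * norm (a - b)" for y
        using L(2)[of "y - a" "y - b"] by (simp add: norm_minus_commute)
      show "?w y = 0" if "y \<notin> ?Q" for y
      proof -
        have "y \<notin> cube a t" "y \<notin> cube b t"
          using near[of y] that by blast+
        then show ?thesis
          by (simp add: bump_kernel_shift_support[OF t])
      qed
    qed (use t f in \<open>auto intro!: borel_measurable_diff bump_kernel_shift_measurable\<close>)
    moreover have "(LINT y|lebesgue. ?w y) = 0"
      using t by (simp add: Bochner_Integration.integral_diff integrable_bump_kernel_shift integral_bump_kernel_shift)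
    moreover have "(LINT y|lebesgue. ?w y *\<^sub>R f y) = smear ?k f a - smear ?k f b"
      using t f by (simp add: scaleR_diff_left smear_def Bochner_Integration.integral_diff integrable_smear)
    ultimately have "norm (smear ?k f a - smear ?k f b)
        \<le> (L * norm (a - b)) * ((t + 2) ^ CARD('n) * mean_oscillation ?Q f)"
      by simp
    also have "\<dots> \<le> (L * norm (a - b)) * ((t + 2) ^ CARD('n) * \<beta>)"
      using L(1) t osc by (intro mult_left_mono) auto
    finally show ?thesis
      by (simp add: algebra_simps)
  qed
  moreover have "0 \<le> \<beta>"
    using osc[of 1] mean_oscillation_nonneg[of _ f] order_trans zero_less_one by blast
  then have "0 \<le> L * ((t + 2) ^ CARD('n) * \<beta>)"
    using L(1) t by simp
  ultimately show thesis
    using that by blast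
qed

lemma continuous_on_smear:
  fixes f :: "real ^ 'n \<Rightarrow> complex"
  assumes t: "0 < t" and f: "f \<in> L1_loc"
    and osc: "\<And>a l. 0 < l \<Longrightarrow> mean_oscillation (cube a l) f \<le> \<beta>"
  shows "continuous_on UNIV (smear (bump_kernel c m t) f)"
proof -
  let ?F = "smear (bump_kernel c m t) f"
  obtain C where C: "0 \<le> C" "\<And>a b. norm (a - b) \<le> 1 \<Longrightarrow> norm (?F a - ?F b) \<le> C * norm (a - b)"
    using smear_diff_bound[OF assms] by blast
  have "isCont ?F a" for a
  proof -
    \<comment> \<open>Radius 1/2 keeps any two points of the ball within distance 1, where the
      Lipschitz estimate is available.\<close>
    have "C-lipschitz_on (ball a (1/2)) ?F"
    proof (rule lipschitz_onI)
      fix x y assume "x \<in> ball a (1/2)" "y \<in> ball a (1/2)"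
      then have "dist x y \<le> 1"
        using dist_triangle_half_l[of x a 1 y] by (simp add: dist_commute less_imp_le)
      then show "dist (?F x) (?F y) \<le> C * dist x y"
        using C(2)[of x y] by (simp add: dist_norm)
    qed (rule C(1))
    then show ?thesis
      using lipschitz_on_continuous_on continuous_on_interior by fastforce
  qed
  then show ?thesis
    by (simp add: continuous_at_imp_continuous_on)
qed

text \<open>The averages of \<open>f\<close> may be unbounded, but a kernel of integral 0 cancels
  them and leaves the oscillation over \<open>cube x t\<close>.\<close>

lemma smear_bounded:
  fixes f :: "real ^ 'n \<Rightarrow> complex"
  assumes t: "0 < t" and f: "f \<in> L1_loc"
    and osc: "\<And>a l. 0 < l \<Longrightarrow> mean_oscillation (cube a l) f \<le> \<beta>"
    and zero: "(LINT y|lebesgue. bump_kernel c m t y) = 0"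
  obtains C where "\<And>x. norm (smear (bump_kernel c m t) f x) \<le> C"
proof -
  let ?k = "bump_kernel c m t"
  obtain B where B: "0 \<le> B" "\<And>x. \<bar>?k x\<bar> \<le> B"
    using bump_kernel_bounded by blast
  have "norm (smear ?k f x) \<le> B * (t ^ CARD('n) * \<beta>)" for x
  proof -
    have "norm ((LINT y|lebesgue. ?k (y - x) *\<^sub>R f y) - (LINT y|lebesgue. ?k (y - x)) *\<^sub>R average (cube x t) f)
      \<le> B * (t ^ CARD('n) * mean_oscillation (cube x t) f)"
      using B t f by (intro weighted_integral_oscillation)
        (auto intro: bump_kernel_shift_measurable bump_kernel_shift_support)
    also have "\<dots> \<le> B * (t ^ CARD('n) * \<beta>)"
      using B(1) t osc by (intro mult_left_mono) auto
    finally show ?thesis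
      using t zero by (simp add: smear_def integral_bump_kernel_shift)
  qed
  then show thesis
    using that by blast
qed

text \<open>The sign of \<open>- c / t\<close> comes from differentiating \<open>k (y - x)\<close> with respect to \<open>x\<close>.\<close>

lemma smear_has_partial:
  fixes f :: "real ^ 'n \<Rightarrow> complex"
  assumes t: "0 < t" and f: "f \<in> L1_loc"
  shows "((\<lambda>s. smear (bump_kernel c m t) f (x + s *\<^sub>R axis i 1)) has_vector_derivative
    smear (bump_kernel (- c / t) (m(i := Suc (m i))) t) f x) (at 0)"
proof -
  let ?k = "bump_kernel c m t" and ?k' = "bump_kernel (- c / t) (m(i := Suc (m i))) t"
  \<comment> \<open>One cube contains the supports of the kernel at \<open>x\<close> and at all
    shifts with \<open>\<bar>s\<bar> \<le> 1\<close>, so the factor \<open>?I\<close> in the error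
    does not depend on \<open>s\<close>.\<close>
  let ?Q = "cube (x - vec 1) (t + 2)"
  let ?I = "LINT y:?Q|lebesgue. norm (f y)"
  obtain L where L: "0 \<le> L" "\<And>x s. \<bar>?k (x + s *\<^sub>R axis i 1) - ?k x
     - s * bump_kernel (c / t) (m(i := Suc (m i))) t x\<bar> \<le> L * s\<^sup>2"
    using bump_kernel_taylor[OF t] by blast
  \<comment> \<open>Moving \<open>x\<close> by s moves \<open>y - x\<close> by -s; this sign is
    absorbed by the constant \<open>- c / t\<close> of \<open>?k'\<close>.\<close>
  have taylor: "\<bar>?k (y - (x + s *\<^sub>R axis i 1)) - ?k (y - x) - s * ?k' (y - x)\<bar> \<le> L * s\<^sup>2" for y s
    using L(2)[of "y - x" "- s"] by (simp add: bump_kernel_def algebra_simps)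
  have est: "norm (smear ?k f (x + s *\<^sub>R axis i 1) - smear ?k f x - s *\<^sub>R smear ?k' f x) \<le> L * s\<^sup>2 * ?I"
    if s: "\<bar>s\<bar> \<le> 1" for s
  proof -
    let ?w = "\<lambda>y. ?k (y - (x + s *\<^sub>R axis i 1)) - ?k (y - x) - s * ?k' (y - x)"
    have near: "y \<in> ?Q" if "y \<in> cube x t \<or> y \<in> cube (x + s *\<^sub>R axis i 1) t" for y
      unfolding mem_cube
    proof
      fix j
      have "\<bar>(s *\<^sub>R axis i 1 :: real ^ 'n) $ j\<bar> \<le> 1"
        using s by (simp add: axis_def)
      then show "(x - vec 1) $ j \<le> y $ j \<and> y $ j \<le> (x - vec 1) $ j + (t + 2)"
        using that unfolding mem_cube abs_le_iff vector_add_component by (auto dest!: spec[of _ j])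
    qed
    have "norm (LINT y|lebesgue. ?w y *\<^sub>R f y) \<le> L * s\<^sup>2 * ?I"
    proof (rule weighted_integral_bound(2))
      show "?w y = 0" if "y \<notin> ?Q" for y
      proof -
        have "y \<notin> cube x t" "y \<notin> cube (x + s *\<^sub>R axis i 1) t"
          using near[of y] that by blast+
        then show ?thesis
          using bump_kernel_shift_support[OF t] by (metis diff_self mult_zero_right)
      qed
    qed (use taylor t f in \<open>auto intro!: borel_measurable_diff borel_measurable_times
          bump_kernel_shift_measurable set_integrable_cube\<close>)
    moreover have "(LINT y|lebesgue. ?w y *\<^sub>R f y)
        = smear ?k f (x + s *\<^sub>R axis i 1) - smear ?k f x - s *\<^sub>R smear ?k' f x"
    proof -
      note int = integrable_smear[OF t f]
      have "(LINT y|lebesgue. ?w y *\<^sub>R f y) = (LINT y|lebesgue. ?k (y - (x + s *\<^sub>R axis i 1)) *\<^sub>R f y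
          - ?k (y - x) *\<^sub>R f y - s *\<^sub>R (?k' (y - x) *\<^sub>R f y))"
        by (simp add: scaleR_diff_left)
      also have "\<dots> = smear ?k f (x + s *\<^sub>R axis i 1) - smear ?k f x - s *\<^sub>R smear ?k' f x"
        unfolding smear_def
        by (simp only: Bochner_Integration.integral_diff Bochner_Integration.integrable_diff
            integrable_scaleR_right integral_scaleR_right int)
      finally show ?thesis .
    qed
    ultimately show ?thesis
      by simp
  qed
  show ?thesis
    unfolding has_vector_derivative_def
  proof (rule has_derivativeI_sandwich[of 1])
    show "bounded_linear (\<lambda>s. s *\<^sub>R smear ?k' f x)"
      by (rule bounded_linear_scaleR_left)
    show "norm (smear ?k f (x + s *\<^sub>R axis i 1) - smear ?k f (x + 0 *\<^sub>R axis i 1)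
        - (s - 0) *\<^sub>R smear ?k' f x) / norm (s - 0) \<le> L * ?I * \<bar>s\<bar>"
      if "s \<noteq> 0" "dist s 0 < 1" for s
      using est[of s] that by (simp add: field_simps power2_eq_square abs_mult_self_eq)
    show "((\<lambda>s. L * ?I * \<bar>s\<bar>) \<longlongrightarrow> 0) (at 0)"
      by (auto intro!: tendsto_eq_intros)
  qed simp
qed

lemma partial_smear:
  assumes "0 < t" "f \<in> L1_loc"
  shows "partial i (smear (bump_kernel c m t) f) = smear (bump_kernel (- c / t) (m(i := Suc (m i))) t) f"
  using vector_derivative_at[OF smear_has_partial[OF assms]] by (auto simp: partial_def)

lemma integral_partial_bump_kernel:
  assumes "0 < t"
  shows "(LINT y|lebesgue. bump_kernel (- c / t) (m(i := Suc (m i))) t y) = 0"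
proof -
  let ?I = "\<lambda>c m. (LINT y|lebesgue. bump_kernel c m t y)"
  \<comment> \<open>The mollification of a constant is constant, so its partial derivative vanishes.\<close>
  have "((\<lambda>_::real. ?I c m *\<^sub>R (1::complex)) has_vector_derivative ?I (- c / t) (m(i := Suc (m i))) *\<^sub>R 1) (at 0)"
    using smear_has_partial[OF assms L1_loc_const[of 1], of c m 0 i] assms by (simp add: smear_const)
  then have "?I (- c / t) (m(i := Suc (m i))) *\<^sub>R (1::complex) = 0"
    using has_vector_derivative_const vector_derivative_unique_at by blast
  then show ?thesis
    by simp
qed

text \<open>Each differentiation changes only the constant and the orders of the kernel. As
  \<open>foldr\<close> applies the head of the list last, a nonempty list leaves a kernel that is
  itself a partial derivative, and such a kernel has integral 0.\<close>

lemma iterated_partial_smear: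
  assumes "0 < t" "f \<in> L1_loc"
  obtains c' m' where "iterated_partial xs (smear (bump_kernel c m t) f) = smear (bump_kernel c' m' t) f"
    "xs \<noteq> [] \<Longrightarrow> (LINT y|lebesgue. bump_kernel c' m' t y) = 0"
proof (cases xs)
  case Nil
  then show thesis
    using that[of c m] by (simp add: iterated_partial_def)
next
  case (Cons i xs')
  have "\<exists>c' m'. iterated_partial ys (smear (bump_kernel c m t) f) = smear (bump_kernel c' m' t) f" for ys
  proof (induction ys)
    case (Cons j ys)
    then show ?case
      unfolding iterated_partial_def foldr.simps comp_def by (metis partial_smear[OF assms])
  qed (auto simp: iterated_partial_def)
  then obtain c' m' where "iterated_partial xs' (smear (bump_kernel c m t) f) = smear (bump_kernel c' m' t) f"
    by blast
  then have "iterated_partial xs (smear (bump_kernel c m t) f) = smear (bump_kernel (- c' / t) (m'(i := Suc (m' i))) t) f"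
    using Cons by (simp add: iterated_partial_def partial_smear[OF assms])
  then show thesis
    using that integral_partial_bump_kernel[OF assms(1)] by blast
qed

lemma smear_C_infinity:
  fixes f :: "real ^ 'n \<Rightarrow> complex"
  assumes t: "0 < t" and f: "f \<in> L1_loc"
    and osc: "\<And>a l. 0 < l \<Longrightarrow> mean_oscillation (cube a l) f \<le> \<beta>"
  shows "smear (bump_kernel c m t) f \<in> C_infinity"
  unfolding C_infinity_def
proof (intro CollectI allI conjI)
  fix xs :: "'n list" and i :: 'n and x :: "real ^ 'n"
  obtain c' m' where eq: "iterated_partial xs (smear (bump_kernel c m t) f) = smear (bump_kernel c' m' t) f"
    using iterated_partial_smear[OF t f] by metis
  show "continuous_on UNIV (iterated_partial xs (smear (bump_kernel c m t) f))"
    unfolding eq by (rule continuous_on_smear[OF assms])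
  show "(\<lambda>s. iterated_partial xs (smear (bump_kernel c m t) f) (x + s *\<^sub>R axis i 1)) differentiable (at 0)"
    unfolding eq using smear_has_partial[OF t f] by (rule differentiableI_vector)
qed

section \<open>Mollification error in BMO\<close>

text \<open>The kernel with constant 1 has values in [0,1] and is at least
  \<open>exp (- 8) ^ CARD('n)\<close> on a cube of side t/2. Dividing by its integral therefore
  gives a bound that scales like t^-n.\<close>

lemma exists_mollifier:
  assumes t: "0 < t"
  obtains c where "\<And>x. \<bar>bump_kernel c (\<lambda>_. 0) t (x :: real ^ 'n)\<bar> \<le> (2 * exp 8 / t) ^ CARD('n)"
    and "(LINT y|lebesgue. bump_kernel c (\<lambda>_. 0) t (y :: real ^ 'n)) = 1"
proof -
  let ?k = "bump_kernel 1 (\<lambda>_. 0) t :: real ^ 'n \<Rightarrow> real"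
  \<comment> \<open>This is the middle half in every coordinate, where \<open>x $ i / t\<close> lies
    in [1/4, 3/4].\<close>
  let ?Q = "cube (vec (t / 4)) (t / 2) :: (real ^ 'n) set"
  let ?I = "LINT y|lebesgue. ?k y"
  have scale: "bump_kernel c (\<lambda>_. 0) t x = c * ?k x" for c and x :: "real ^ 'n"
    by (simp add: bump_kernel_def)
  have k01: "0 \<le> ?k x" "?k x \<le> 1" for x
    by (auto simp: bump_kernel_def bump_0_nonneg bump_0_le_1 intro!: prod_nonneg prod_le_1)
  have lower: "exp (- 8) ^ CARD('n) \<le> ?k x" if "x \<in> ?Q" for x
  proof -
    have "exp (- 8) \<le> bump 0 (x $ i / t)" for i
      using that t by (intro bump_0_lower) (auto simp: mem_cube field_simps dest!: spec[of _ i])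
    then have "(\<Prod>i\<in>(UNIV :: 'n set). exp (- 8)) \<le> (\<Prod>i\<in>UNIV. bump 0 (x $ i / t))"
      by (intro prod_mono) auto
    then show ?thesis
      by (simp add: bump_kernel_def)
  qed
  have "(t / 2) ^ CARD('n) * exp (- 8) ^ CARD('n) = (LINT y:?Q|lebesgue. exp (- 8) ^ CARD('n))"
    using t by (subst set_integral_const_cube) auto
  also have "\<dots> \<le> ?I"
    unfolding set_lebesgue_integral_def
  proof (rule integral_mono)
    show "integrable lebesgue (\<lambda>x. indicator ?Q x *\<^sub>R exp (- 8 :: real) ^ CARD('n))"
      using set_integrable_const_cube unfolding set_integrable_def .
    show "integrable lebesgue ?k"
      using integrable_bump_kernel_shift[OF t, of 1 "\<lambda>_. 0" 0] by simp
    show "indicator ?Q x *\<^sub>R exp (- 8) ^ CARD('n) \<le> ?k x" for x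
      using lower[of x] k01(1)[of x] by (auto simp: indicator_def)
  qed
  finally have I: "(t * exp (- 8) / 2) ^ CARD('n) \<le> ?I"
    by (simp add: power_mult_distrib power_divide)
  moreover have pos: "0 < (t * exp (- 8) / 2) ^ CARD('n)"
    using t by simp
  ultimately have I_pos: "0 < ?I"
    by linarith
  show thesis
  proof (rule that[of "1 / ?I"])
    fix x :: "real ^ 'n"
    have "\<bar>bump_kernel (1 / ?I) (\<lambda>_. 0) t x\<bar> = ?k x / ?I"
      using I_pos k01(1)[of x] by (subst scale) (simp add: abs_mult)
    also have "\<dots> \<le> 1 / (t * exp (- 8) / 2) ^ CARD('n)"
      using I pos k01[of x] by (intro frac_le) auto
    also have "\<dots> = (2 * exp 8 / t) ^ CARD('n)"
      by (simp add: exp_minus field_simps flip: power_one_over)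
    finally show "\<bar>bump_kernel (1 / ?I) (\<lambda>_. 0) t x\<bar> \<le> (2 * exp 8 / t) ^ CARD('n)" .
  next
    show "(LINT y|lebesgue. bump_kernel (1 / ?I) (\<lambda>_. 0) t (y :: real ^ 'n)) = 1"
      by (subst scale) (use I_pos in simp)
  qed
qed

text \<open>The support \<open>cube x t\<close> lies in \<open>cube z (2 * t)\<close>. The bound
  (M/t)^n of the kernel and the volume (2t)^n of this cube multiply to (2M)^n, so the scale
  cancels.\<close>

lemma smear_mollifier_error:
  fixes f :: "real ^ 'n \<Rightarrow> complex"
  assumes t: "0 < t" and f: "f \<in> L1_loc"
    and k: "\<And>x :: real ^ 'n. \<bar>bump_kernel c m t x\<bar> \<le> (M / t) ^ CARD('n)"
    and I: "(LINT y|lebesgue. bump_kernel c m t (y :: real ^ 'n)) = 1"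
    and x: "x \<in> cube z t"
  shows "norm (smear (bump_kernel c m t) f x - average (cube z (2 * t)) f)
    \<le> (2 * M) ^ CARD('n) * mean_oscillation (cube z (2 * t)) f"
proof -
  have sub: "cube x t \<subseteq> cube z (2 * t)"
    using x by (auto simp: mem_cube) (smt (verit))+
  have "norm ((LINT y|lebesgue. bump_kernel c m t (y - x) *\<^sub>R f y)
      - (LINT y|lebesgue. bump_kernel c m t (y - x)) *\<^sub>R average (cube z (2 * t)) f)
    \<le> (M / t) ^ CARD('n) * ((2 * t) ^ CARD('n) * mean_oscillation (cube z (2 * t)) f)"
    using t f k sub by (intro weighted_integral_oscillation)
      (auto intro!: bump_kernel_shift_measurable bump_kernel_shift_support)
  then show ?thesis
    using t I by (simp add: smear_def integral_bump_kernel_shift power_divide power_mult_distrib mult_ac)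
qed

text \<open>Tonelli: up to the factor \<open>t ^ CARD('n)\<close>, the integral of \<open>norm (g x)\<close> over a large cube is an
  integral over \<open>z\<close> of its integrals over the parts in \<open>cube z t\<close>; this avoids subdividing the large cube.\<close>

lemma set_integral_large_cube_le:
  fixes g :: "real ^ 'n \<Rightarrow> complex"
  assumes g: "g \<in> L1_loc" and tl: "0 < t" "t \<le> l"
    and A: "\<And>z. (LINT x:cube z t|lebesgue. norm (g x)) \<le> t ^ CARD('n) * A"
  shows "(LINT x:cube a l|lebesgue. norm (g x)) \<le> (2 * l) ^ CARD('n) * A"
proof -
  let ?Q = "cube a l" and ?n = "CARD('n)"
  define u where "u x = ennreal (indicator ?Q x *\<^sub>R norm (g x))" for x
  have int: "integrable lebesgue (\<lambda>x. indicator (cube b r) x *\<^sub>R norm (g x))" for b r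
    using set_integrable_norm[OF set_integrable_cube[OF g]] by (simp add: set_integrable_def)
  have "u \<in> borel_measurable lebesgue"
    unfolding u_def using int by (intro measurable_compose[OF _ measurable_ennreal] borel_measurable_integrable)
  \<comment> \<open>A Borel representative of the Lebesgue measurable \<open>u\<close> makes the
    integrand measurable on the product space.\<close>
  then obtain u' where [measurable]: "u' \<in> borel_measurable lborel" and uu': "AE x in lborel. u x = u' x"
    using completion_ex_borel_measurable by blast
  have em_cube: "emeasure lborel (cube b r) = ennreal (r ^ ?n)" if "0 \<le> r" for b :: "real ^ 'n" and r
  proof -
    have "emeasure lborel (cube b r) = emeasure lebesgue (cube b r)"
      by (simp add: borel_cube)
    also have "\<dots> = ennreal (measure lebesgue (cube b r))"
      using emeasure_cube_finite[of b r] by (intro emeasure_eq_ennreal_measure) auto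
    finally show ?thesis
      using that by (simp add: measure_cube)
  qed
  have A0: "0 \<le> A"
    using order_trans[OF set_integral_nonneg A] zero_less_power[OF tl(1), of ?n]
    by (auto simp: zero_le_mult_iff)
  \<comment> \<open>The inner integral vanishes unless \<open>cube z t\<close> meets
    \<open>?Q\<close>, which confines \<open>z\<close> to a cube of side l + t.\<close>
  have small: "(\<integral>\<^sup>+ x. u' x * indicator (cube z t) x \<partial>lborel)
      \<le> ennreal (t ^ ?n * A) * indicator (cube (a - vec t) (l + t)) z" for z
  proof (cases "z \<in> cube (a - vec t) (l + t)")
    case False
    have zero: "u x * indicator (cube z t) x = 0" for x
    proof (rule ccontr)
      assume "u x * indicator (cube z t) x \<noteq> 0"
      then have "x \<in> ?Q" "x \<in> cube z t"
        by (auto simp: u_def indicator_def split: if_splits)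
      then have "z \<in> cube (a - vec t) (l + t)"
        by (auto simp: mem_cube) (smt (verit))+
      with False show False by blast
    qed
    have "AE x in lborel. u' x * indicator (cube z t) x = 0"
      using uu' by (rule eventually_mono) (metis zero)
    then have "(\<integral>\<^sup>+ x. u' x * indicator (cube z t) x \<partial>lborel) = (\<integral>\<^sup>+ (x :: real ^ 'n). 0 \<partial>lborel)"
      by (rule nn_integral_cong_AE)
    then show ?thesis by simp
  next
    case True
    have le: "u x * indicator (cube z t) x \<le> ennreal (indicator (cube z t) x *\<^sub>R norm (g x))" for x
      by (auto simp: u_def indicator_def)
    have "(\<integral>\<^sup>+ x. u' x * indicator (cube z t) x \<partial>lborel)
        \<le> (\<integral>\<^sup>+ x. ennreal (indicator (cube z t) x *\<^sub>R norm (g x)) \<partial>lborel)"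
      using uu' by (intro nn_integral_mono_AE, elim eventually_mono) (metis le)
    also have "\<dots> = (\<integral>\<^sup>+ x. ennreal (indicator (cube z t) x *\<^sub>R norm (g x)) \<partial>lebesgue)"
      by (simp add: nn_integral_completion)
    also have "\<dots> = ennreal (LINT x:cube z t|lebesgue. norm (g x))"
      unfolding set_lebesgue_integral_def by (intro nn_integral_eq_integral int) auto
    also have "\<dots> \<le> ennreal (t ^ ?n * A)"
      by (intro ennreal_leI A)
    finally show ?thesis
      using True by simp
  qed
  have meas: "Measurable.pred (lborel \<Otimes>\<^sub>M lborel) (\<lambda>p :: (real ^ 'n) \<times> (real ^ 'n). fst p \<in> cube (snd p) t)"
  proof -
    have "closed {p :: (real ^ 'n) \<times> (real ^ 'n). \<forall>i. snd p $ i \<le> fst p $ i \<and> fst p $ i \<le> snd p $ i + t}"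
      by (intro closed_Collect_all closed_Collect_conj closed_Collect_le continuous_intros)
    then have "{p :: (real ^ 'n) \<times> (real ^ 'n). fst p \<in> cube (snd p) t} \<in> sets borel"
      by (simp add: mem_cube)
    then show ?thesis
      by (simp add: pred_def space_pair_measure borel_prod[symmetric] cong: sets_pair_measure_cong)
  qed
  \<comment> \<open>Read as a condition on \<open>z\<close>, membership of \<open>x\<close> in
    \<open>cube z t\<close> describes a cube of side t; integrating over \<open>z\<close> gives the
    factor t^n.\<close>
  have swap: "(indicator (cube z t) x :: ennreal) = indicator (cube (x - vec t) t) z" for x z :: "real ^ 'n"
    by (simp add: indicator_def mem_cube diff_le_eq conj_commute)
  have inner: "(\<integral>\<^sup>+ z. u' x * indicator (cube (x - vec t) t) z \<partial>lborel) = ennreal (t ^ ?n) * u' x" for x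
    using tl by (subst nn_integral_cmult) (auto simp: em_cube mult.commute borel_cube borel_measurable_indicator)
  have "ennreal (t ^ ?n) * (\<integral>\<^sup>+ x. u' x \<partial>lborel) = (\<integral>\<^sup>+ x. (\<integral>\<^sup>+ z. u' x * indicator (cube (x - vec t) t) z \<partial>lborel) \<partial>lborel)"
    unfolding inner by (simp add: nn_integral_cmult)
  also have "\<dots> = (\<integral>\<^sup>+ x. (\<integral>\<^sup>+ z. u' x * indicator (cube z t) x \<partial>lborel) \<partial>lborel)"
    by (intro nn_integral_cong arg_cong2[where f = "(*)"] refl swap[symmetric])
  also have "\<dots> = (\<integral>\<^sup>+ z. (\<integral>\<^sup>+ x. u' x * indicator (cube z t) x \<partial>lborel) \<partial>lborel)"
  proof -
    have "(\<lambda>p. u' (fst p) * (if fst p \<in> cube (snd p) t then 1 else 0)) \<in> borel_measurable (lborel \<Otimes>\<^sub>M lborel)"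
      using meas by measurable
    then have "(\<lambda>(x, z). u' x * indicator (cube z t) x) \<in> borel_measurable (lborel \<Otimes>\<^sub>M lborel)"
      by (simp add: indicator_def case_prod_unfold of_bool_def)
    then show ?thesis
      by (rule lborel_pair.Fubini'[symmetric])
  qed
  also have "\<dots> \<le> (\<integral>\<^sup>+ z. ennreal (t ^ ?n * A) * indicator (cube (a - vec t) (l + t)) z \<partial>lborel)"
    by (intro nn_integral_mono small)
  also have "\<dots> = ennreal (t ^ ?n * A) * ennreal ((l + t) ^ ?n)"
    using tl by (subst nn_integral_cmult) (auto simp: em_cube borel_cube borel_measurable_indicator)
  also have "(\<integral>\<^sup>+ x. u' x \<partial>lborel) = (\<integral>\<^sup>+ x. u x \<partial>lebesgue)"
    using uu' by (subst nn_integral_completion) (auto intro!: nn_integral_cong_AE elim!: eventually_mono)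
  also have "\<dots> = ennreal (LINT x:?Q|lebesgue. norm (g x))"
    unfolding set_lebesgue_integral_def u_def by (intro nn_integral_eq_integral int) auto
  finally have "ennreal (t ^ ?n * (LINT x:?Q|lebesgue. norm (g x))) \<le> ennreal (t ^ ?n * (A * (l + t) ^ ?n))"
    using tl A0 by (simp add: ennreal_mult'[symmetric] set_integral_nonneg mult.assoc)
  then have "(LINT x:?Q|lebesgue. norm (g x)) \<le> A * (l + t) ^ ?n"
    using tl A0 by (subst (asm) ennreal_le_iff) auto
  also have "\<dots> \<le> A * (2 * l) ^ ?n"
    using tl A0 by (intro mult_left_mono power_mono) auto
  finally show ?thesis
    by (simp add: mult.commute)
qed

lemma L1_loc_diff: "f \<in> L1_loc \<Longrightarrow> g \<in> L1_loc \<Longrightarrow> (\<lambda>x. f x - g x) \<in> L1_loc"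
  by (simp add: L1_loc_def)

lemma L1_loc_continuous:
  assumes "continuous_on UNIV f"
  shows "f \<in> L1_loc"
  unfolding L1_loc_def
proof (intro CollectI allI impI)
  fix K :: "(real ^ 'a) set"
  assume "compact K"
  then have "set_integrable lborel K f"
    unfolding set_integrable_def
    using borel_integrable_compact[of K f] continuous_on_subset[OF assms]
    by (simp add: indicator_def of_bool_def if_distrib[of "\<lambda>c. c *\<^sub>R _"] cong: if_cong)
  then show "set_integrable lebesgue K f"
    unfolding set_integrable_def
    using \<open>compact K\<close> borel_measurable_continuous_onI[OF assms]
    by (subst integrable_completion) (auto intro: borel_compact)
qed

text \<open>In the constant, 1 accounts for \<open>f\<close> itself on small cubes,
  \<open>2 ^ CARD('n)\<close> for passing to the doubled cube, and \<open>(2 * M) ^ CARD('n)\<close>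
  for the mollification error. The outer factor 2 comes from replacing the average by a constant,
  the other \<open>2 ^ CARD('n)\<close> from the estimate on large cubes.\<close>

lemma smear_mollifier_oscillation:
  fixes f :: "real ^ 'n \<Rightarrow> complex"
  assumes t: "0 < t" and f: "f \<in> L1_loc" and M: "0 \<le> M"
    and k: "\<And>x :: real ^ 'n. \<bar>bump_kernel c m t x\<bar> \<le> (M / t) ^ CARD('n)"
    and I: "(LINT y|lebesgue. bump_kernel c m t (y :: real ^ 'n)) = 1"
    and F: "smear (bump_kernel c m t) f \<in> L1_loc"
    and eps: "\<And>a l. 0 < l \<Longrightarrow> l \<le> 2 * t \<Longrightarrow> mean_oscillation (cube a l) f \<le> \<epsilon>"
    and l: "0 < l"
  shows "mean_oscillation (cube a l) (\<lambda>x. f x - smear (bump_kernel c m t) f x)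
    \<le> (1 + 2 * 2 ^ CARD('n) * (2 ^ CARD('n) + (2 * M) ^ CARD('n))) * \<epsilon>"
proof -
  let ?F = "smear (bump_kernel c m t) f" and ?n = "CARD('n)"
  let ?c = "\<lambda>z. average (cube z (2 * t)) f"
  have eps0: "0 \<le> \<epsilon>"
    using order_trans[OF mean_oscillation_nonneg eps[of t 0]] t by simp
  have ptw: "norm (?F x - ?c z) \<le> (2 * M) ^ ?n * \<epsilon>" if "x \<in> cube z t" for x z
    using smear_mollifier_error[OF t f k I that] eps[of "2 * t" z] t M
    by (meson mult_left_mono mult_nonneg_nonneg order.refl order_trans zero_le_numeral zero_le_power
        mult_pos_pos zero_less_numeral)
  have F_int: "(LINT x:cube z r|lebesgue. norm (?F x - ?c z)) \<le> r ^ ?n * ((2 * M) ^ ?n * \<epsilon>)" if r: "0 < r" "r \<le> t" for z r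
  proof -
    have "cube z r \<subseteq> cube z t"
      using r by (auto simp: mem_cube) (smt (verit))
    then have "(LINT x:cube z r|lebesgue. norm (?F x - ?c z)) \<le> (LINT x:cube z r|lebesgue. (2 * M) ^ ?n * \<epsilon>)"
      by (intro set_integral_mono set_integrable_norm_diff_const F set_integrable_const_cube ptw) auto
    then show ?thesis
      using r by (simp add: set_integral_const_cube mult_ac)
  qed
  show ?thesis
  proof (cases "l \<le> t")
    case True
    \<comment> \<open>On a small cube \<open>f\<close> and \<open>?F\<close> are treated separately:
      the first oscillates little by assumption, and the second is close to the constant
      \<open>?c a\<close>.\<close>
    have "mean_oscillation (cube a l) (\<lambda>x. f x - ?F x) \<le> mean_oscillation (cube a l) f + mean_oscillation (cube a l) ?F"
      by (intro mean_oscillation_diff_le f F l)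
    also have "mean_oscillation (cube a l) ?F \<le> 2 * (LINT x:cube a l|lebesgue. norm (?F x - ?c a)) / l ^ ?n"
      by (intro mean_oscillation_le F l)
    also have "\<dots> \<le> 2 * (l ^ ?n * ((2 * M) ^ ?n * \<epsilon>)) / l ^ ?n"
      using l True by (intro divide_right_mono mult_left_mono F_int) auto
    also have "\<dots> = 2 * 1 * ((2 * M) ^ ?n * \<epsilon>)"
      using l by simp
    also have "\<dots> \<le> 2 * 2 ^ ?n * ((2 ^ ?n + (2 * M) ^ ?n) * \<epsilon>)"
      using eps0 M by (intro mult_mono mult_right_mono) auto
    also have "mean_oscillation (cube a l) f \<le> \<epsilon>"
      using l t True by (intro eps) auto
    finally show ?thesis
      by (simp add: algebra_simps)
  next
    case False
    \<comment> \<open>On a large cube \<open>f\<close> alone may oscillate much. Instead the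
      difference is small in mean on every cube of side t, since both functions are close to
      \<open>?c z\<close> there.\<close>
    have small: "(LINT x:cube z t|lebesgue. norm (f x - ?F x)) \<le> t ^ ?n * ((2 ^ ?n + (2 * M) ^ ?n) * \<epsilon>)" for z
    proof -
      have sub: "cube z t \<subseteq> cube z (2 * t)"
        using t by (auto simp: mem_cube) (smt (verit))
      have "(LINT x:cube z t|lebesgue. norm (f x - ?F x))
          \<le> (LINT x:cube z t|lebesgue. norm (f x - ?c z) + norm (?F x - ?c z))"
        using norm_triangle_ineq4[of "f _ - ?c z" "?F _ - ?c z"]
        by (intro set_integral_mono set_integral_add set_integrable_norm_diff_const
            set_integrable_norm set_integrable_cube L1_loc_diff f F) auto
      also have "\<dots> = (LINT x:cube z t|lebesgue. norm (f x - ?c z)) + (LINT x:cube z t|lebesgue. norm (?F x - ?c z))"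
        by (intro set_integral_add set_integrable_norm_diff_const f F)
      also have "(LINT x:cube z t|lebesgue. norm (f x - ?c z)) \<le> (LINT x:cube z (2 * t)|lebesgue. norm (f x - ?c z))"
        using sub by (intro set_integral_nonneg_mono_set set_integrable_norm_diff_const f) auto
      also have "\<dots> \<le> (2 * t) ^ ?n * \<epsilon>"
        using t eps[of "2 * t" z] by (simp add: set_integral_norm_diff_average)
      also have "(LINT x:cube z t|lebesgue. norm (?F x - ?c z)) \<le> t ^ ?n * ((2 * M) ^ ?n * \<epsilon>)"
        using t by (intro F_int) auto
      finally show ?thesis
        by (simp add: algebra_simps power_mult_distrib)
    qed
    have "mean_oscillation (cube a l) (\<lambda>x. f x - ?F x) \<le> 2 * (LINT x:cube a l|lebesgue. norm (f x - ?F x - 0)) / l ^ ?n"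
      by (intro mean_oscillation_le L1_loc_diff f F l)
    also have "\<dots> \<le> 2 * ((2 * l) ^ ?n * ((2 ^ ?n + (2 * M) ^ ?n) * \<epsilon>)) / l ^ ?n"
      using False t l set_integral_large_cube_le[OF L1_loc_diff[OF f F] t _ small, of l a]
      by (intro divide_right_mono mult_left_mono) auto
    also have "\<dots> = 2 * 2 ^ ?n * (2 ^ ?n + (2 * M) ^ ?n) * \<epsilon>"
      using l by (simp add: power_mult_distrib)
    finally show ?thesis
      using eps0 by (simp add: algebra_simps)
  qed
qed

section \<open>Density in VMO\<close>

text \<open>Each doubling of a cube moves the average of \<open>f\<close> by at most a multiple of
  \<beta>, and the number of doublings needed before a cube around one point contains a cube around
  the other is logarithmic in their distance.\<close>

lemma smear_log_growth:
  fixes f :: "real ^ 'n \<Rightarrow> complex"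
  assumes t: "0 < t" "t \<le> 1" and f: "f \<in> L1_loc"
    and osc: "\<And>a l. 0 < l \<Longrightarrow> mean_oscillation (cube a l) f \<le> \<beta>"
  obtains C where "0 \<le> C"
    "\<And>a b. 1 < norm (a - b) \<Longrightarrow> norm (smear (bump_kernel c m t) f a - smear (bump_kernel c m t) f b) \<le> C * (1 + ln (norm (a - b)))"
proof -
  let ?k = "bump_kernel c m t" and ?n = "CARD('n)"
  let ?F = "smear ?k f" and ?I = "LINT y|lebesgue. bump_kernel c m t y"
  \<comment> \<open>The cube centred at \<open>a\<close> with side 2 * 2^k.\<close>
  define Q where "Q k a = cube (a - vec (2 ^ k)) (2 * 2 ^ k)" for k :: nat and a :: "real ^ 'n"
  obtain B where B: "0 \<le> B" "\<And>x. \<bar>?k x\<bar> \<le> B"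
    using bump_kernel_bounded by blast
  have beta0: "0 \<le> \<beta>"
    using order_trans[OF mean_oscillation_nonneg osc[of 1 0]] by simp
  \<comment> \<open>By t <= 1 the support \<open>cube a t\<close> lies in \<open>Q 0 a\<close>. The
    integral \<open>?I\<close> stays general so that derivative kernels, with \<open>?I\<close> = 0,
    are covered too.\<close>
  have start: "norm (?F a - ?I *\<^sub>R average (Q 0 a) f) \<le> B * (2 ^ ?n * \<beta>)" for a
  proof -
    have sub: "cube a t \<subseteq> cube (a - vec 1) 2"
      using t by (auto simp: mem_cube) (smt (verit))+
    have "norm ((LINT y|lebesgue. ?k (y - a) *\<^sub>R f y) - (LINT y|lebesgue. ?k (y - a)) *\<^sub>R average (cube (a - vec 1) 2) f)
        \<le> B * (2 ^ ?n * mean_oscillation (cube (a - vec 1) 2) f)"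
      using t f B sub by (intro weighted_integral_oscillation)
        (auto intro!: bump_kernel_shift_measurable bump_kernel_shift_support)
    also have "\<dots> \<le> B * (2 ^ ?n * \<beta>)"
      using B osc by (intro mult_left_mono) auto
    finally show ?thesis
      using t by (simp add: smear_def integral_bump_kernel_shift Q_def)
  qed
  \<comment> \<open>Used with b = a for one doubling, and with b different from a to cross from one
    centre to the other.\<close>
  have step: "norm (average (Q k b) f - average (Q (Suc k) a) f) \<le> 2 ^ ?n * \<beta>"
    if "norm (a - b) \<le> 2 ^ k" for k a b
  proof -
    have "\<bar>a $ i - b $ i\<bar> \<le> 2 ^ k" for i
      using component_le_norm_cart[of "a - b" i] that by simp
    then have "Q k b \<subseteq> Q (Suc k) a"
      by (auto simp: Q_def mem_cube abs_le_iff) (smt (verit))+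
    then have "norm (average (Q k b) f - average (Q (Suc k) a) f)
        \<le> (2 * 2 ^ Suc k / (2 * 2 ^ k)) ^ ?n * mean_oscillation (Q (Suc k) a) f"
      unfolding Q_def by (intro average_subcube_diff_le f) auto
    also have "\<dots> \<le> 2 ^ ?n * \<beta>"
      using osc by (simp add: Q_def mult_left_mono)
    finally show ?thesis .
  qed
  have telescope: "norm (average (Q 0 a) f - average (Q k a) f) \<le> real k * (2 ^ ?n * \<beta>)" for k a
  proof (induction k)
    case (Suc k)
    have "norm (average (Q 0 a) f - average (Q (Suc k) a) f)
        \<le> norm (average (Q 0 a) f - average (Q k a) f) + norm (average (Q k a) f - average (Q (Suc k) a) f)"
      using dist_triangle[of "average (Q 0 a) f" "average (Q (Suc k) a) f" "average (Q k a) f"]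
      by (simp add: dist_norm)
    then show ?case
      using Suc step[of a a k] by (simp add: algebra_simps)
  qed simp
  define D where "D = 2 ^ ?n * \<beta>"
  have D0: "0 \<le> D"
    using beta0 by (simp add: D_def)
  have "norm (?F a - ?F b) \<le> (2 * B * D + 4 * \<bar>?I\<bar> * D) * (1 + ln (norm (a - b)))"
    if ab: "1 < norm (a - b)" for a b
  proof -
    \<comment> \<open>Rounding up makes 2^k at least the distance, while k exceeds its binary
      logarithm by at most 1.\<close>
    define k where "k = nat \<lceil>log 2 (norm (a - b))\<rceil>"
    have ln0: "0 < ln (norm (a - b))"
      by (rule ln_gt_zero[OF ab])
    then have log0: "0 < log 2 (norm (a - b))"
      by (simp add: log_def)
    have k: "log 2 (norm (a - b)) \<le> real k" "real k \<le> log 2 (norm (a - b)) + 1"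
      using log0 by (auto simp: k_def intro: of_nat_ceiling)
    have "norm (a - b) = 2 powr (log 2 (norm (a - b)))"
      using ab by (subst powr_log_cancel) auto
    also have "\<dots> \<le> 2 powr (real k)"
      using k(1) by (intro powr_mono) auto
    finally have dist: "norm (a - b) \<le> 2 ^ k"
      by (simp add: powr_realpow)
    have "log 2 (norm (a - b)) \<le> 2 * ln (norm (a - b))"
    proof -
      have "1 / 2 \<le> ln (2::real)"
        using ln_le_minus_one[of "1 / 2"] by (simp add: ln_div)
      then show ?thesis
        using ln0 mult_right_mono[of "1/2" "ln 2" "2 * ln (norm (a - b))"]
        by (simp add: log_def field_simps)
    qed
    with k(2) have k_le: "2 * real k + 2 \<le> 4 * (1 + ln (norm (a - b)))"
      by simp
    let ?A = "\<lambda>k a. average (Q k a) f"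
    \<comment> \<open>The chain of cubes goes up from \<open>Q 0 a\<close> to
      \<open>Q (Suc k) a\<close>, across to \<open>Q k b\<close>, and down to
      \<open>Q 0 b\<close>.\<close>
    have "norm (?A 0 a - ?A 0 b) \<le> norm (?A 0 a - ?A (Suc k) a) + norm (?A k b - ?A (Suc k) a) + norm (?A 0 b - ?A k b)"
      by norm
    also have "\<dots> \<le> real (Suc k) * D + D + real k * D"
      using telescope[of a "Suc k"] step[OF dist] telescope[of b k] unfolding D_def
      by (intro add_mono) auto
    also have "\<dots> = (2 * real k + 2) * D"
      by (simp add: algebra_simps)
    also have "\<dots> \<le> 4 * (1 + ln (norm (a - b))) * D"
      using k_le D0 by (intro mult_right_mono)
    finally have avg: "norm (?A 0 a - ?A 0 b) \<le> 4 * (1 + ln (norm (a - b))) * D" .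
    have tri: "norm (p - q + r) \<le> norm p + norm q + norm r" for p q r :: complex
      by norm
    have "?F a - ?F b = (?F a - ?I *\<^sub>R ?A 0 a) - (?F b - ?I *\<^sub>R ?A 0 b) + ?I *\<^sub>R (?A 0 a - ?A 0 b)"
      by (simp add: algebra_simps)
    then have "norm (?F a - ?F b) \<le> norm (?F a - ?I *\<^sub>R ?A 0 a) + norm (?F b - ?I *\<^sub>R ?A 0 b) + norm (?I *\<^sub>R (?A 0 a - ?A 0 b))"
      by (simp only: tri)
    also have "\<dots> \<le> B * D + B * D + \<bar>?I\<bar> * (4 * (1 + ln (norm (a - b))) * D)"
      using start[of a] start[of b] avg unfolding D_def
      by (intro add_mono) (auto intro: mult_left_mono)
    also have "\<dots> \<le> (2 * B * D) * (1 + ln (norm (a - b))) + \<bar>?I\<bar> * (4 * (1 + ln (norm (a - b))) * D)"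
      using B(1) D0 ln0 mult_left_mono[of 1 "1 + ln (norm (a - b))" "2 * B * D"] by simp
    finally show ?thesis
      by (simp add: algebra_simps)
  qed
  moreover have "0 \<le> 2 * B * D + 4 * \<bar>?I\<bar> * D"
    using B(1) D0 by simp
  ultimately show thesis
    using that by blast
qed

lemma smear_Upsilon_sharp:
  fixes f :: "real ^ 'n \<Rightarrow> complex"
  assumes t: "0 < t" "t \<le> 1" and f: "f \<in> L1_loc"
    and osc: "\<And>a l. 0 < l \<Longrightarrow> mean_oscillation (cube a l) f \<le> \<beta>"
  obtains C where "0 < C"
    "\<And>a b. norm (smear (bump_kernel c m t) f a - smear (bump_kernel c m t) f b) \<le> C * Upsilon_sharp (norm (a - b))"
proof -
  let ?F = "smear (bump_kernel c m t) f"
  obtain C1 where C1: "0 \<le> C1" "\<And>a b. norm (a - b) \<le> 1 \<Longrightarrow> norm (?F a - ?F b) \<le> C1 * norm (a - b)"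
    using smear_diff_bound[OF t(1) f osc] by blast
  obtain C2 where C2: "0 \<le> C2" "\<And>a b. 1 < norm (a - b) \<Longrightarrow> norm (?F a - ?F b) \<le> C2 * (1 + ln (norm (a - b)))"
    using smear_log_growth[OF t f osc] by blast
  \<comment> \<open>The summand 1 makes the common constant strictly positive.\<close>
  have "norm (?F a - ?F b) \<le> (C1 + C2 + 1) * Upsilon_sharp (norm (a - b))" for a b
  proof (cases "norm (a - b) \<le> 1")
    case True
    have "norm (?F a - ?F b) \<le> C1 * norm (a - b)"
      using C1(2) True by blast
    also have "\<dots> \<le> (C1 + C2 + 1) * norm (a - b)"
      using C2(1) by (intro mult_right_mono) auto
    finally show ?thesis
      using True by (simp add: Upsilon_sharp_piecewise)
  next
    case False
    have "norm (?F a - ?F b) \<le> C2 * (1 + ln (norm (a - b)))"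
      using C2(2) False by simp
    also have "\<dots> \<le> (C1 + C2 + 1) * (1 + ln (norm (a - b)))"
      using C1(1) False by (intro mult_right_mono) (auto intro: add_nonneg_nonneg)
    finally show ?thesis
      using False by (simp add: Upsilon_sharp_piecewise)
  qed
  then show thesis
    using that[of "C1 + C2 + 1"] C1(1) C2(1) by simp
qed

lemma C_modulusI:
  assumes C: "0 < C" "\<And>a b. norm (f a - f b) \<le> C * Upsilon_sharp (norm (a - b))"
    and \<Upsilon>: "\<exists>C::real. 0 < C \<and> (\<forall>s\<ge>0. ennreal (Upsilon_sharp s) \<le> ennreal C * \<Upsilon> s)"
  shows "f \<in> C_modulus \<Upsilon>"
proof -
  obtain D where D: "0 < D" "\<And>s. 0 \<le> s \<Longrightarrow> ennreal (Upsilon_sharp s) \<le> ennreal D * \<Upsilon> s"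
    using \<Upsilon> by blast
  have "ennreal (norm (f a - f b)) \<le> ennreal (C * D) * \<Upsilon> (norm (a - b))" for a b
  proof -
    have "ennreal (norm (f a - f b)) \<le> ennreal (C * Upsilon_sharp (norm (a - b)))"
      by (rule ennreal_leI) (rule C(2))
    also have "\<dots> = ennreal C * ennreal (Upsilon_sharp (norm (a - b)))"
      using C(1) by (intro ennreal_mult') simp
    also have "\<dots> \<le> ennreal C * (ennreal D * \<Upsilon> (norm (a - b)))"
      by (intro mult_left_mono D(2)) auto
    also have "\<dots> = ennreal (C * D) * \<Upsilon> (norm (a - b))"
      using C(1) by (simp add: ennreal_mult' mult.assoc)
    finally show ?thesis .
  qed
  then show ?thesis
    unfolding C_modulus_def using C(1) D(1) by (intro CollectI exI[of _ "C * D"]) auto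
qed

section \<open>From suprema over cubes to BMO and VMO\<close>

lemma mean_oscillation_le_BMO_seminorm:
  "0 < l \<Longrightarrow> ennreal (mean_oscillation (cube a l) f) \<le> BMO_seminorm f"
  unfolding BMO_seminorm_def by (rule SUP_upper2[of "(a, l)"]) auto

lemma BMO_seminorm_leI:
  "(\<And>a l. 0 < l \<Longrightarrow> mean_oscillation (cube a l) f \<le> C) \<Longrightarrow> BMO_seminorm f \<le> ennreal C"
  unfolding BMO_seminorm_def by (auto intro!: SUP_least ennreal_leI)

lemma BMO_mean_oscillation_bound:
  assumes "f \<in> BMO"
  obtains \<beta> where "\<And>a l. 0 < l \<Longrightarrow> mean_oscillation (cube a l) f \<le> \<beta>"
proof (rule that)
  fix a and l :: real assume "0 < l"
  then show "mean_oscillation (cube a l) f \<le> enn2real (BMO_seminorm f)"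
    using mean_oscillation_le_BMO_seminorm[of l a f] assms
    by (metis (no_types, lifting) BMO_def ennreal_enn2real_if ennreal_le_iff enn2real_nonneg infinity_ennreal_def mem_Collect_eq top.not_eq_extremum)
qed

lemma VMO_small_oscillation:
  assumes "f \<in> VMO" "0 < \<epsilon>"
  obtains \<delta> where "0 < \<delta>" "\<And>a l. 0 < l \<Longrightarrow> l \<le> \<delta> \<Longrightarrow> mean_oscillation (cube a l) f \<le> \<epsilon>"
proof -
  let ?S = "\<lambda>r. SUP (a, l) \<in> UNIV \<times> {0<..r}. ennreal (mean_oscillation (cube a l) f)"
  have "(?S \<longlongrightarrow> 0) (at_right 0)"
    using assms(1) by (simp add: VMO_def)
  then have "eventually (\<lambda>r. ?S r < ennreal \<epsilon>) (at_right 0)"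
    using assms(2) by (intro order_tendstoD(2)) auto
  then obtain d where d: "0 < d" "\<And>r. 0 < r \<Longrightarrow> r < d \<Longrightarrow> ?S r < ennreal \<epsilon>"
    by (auto simp: eventually_at_right_field)
  show thesis
  \<comment> \<open>The supremum is controlled for r strictly below \<open>d\<close>, while the
    claim admits equality with the threshold; hence half of \<open>d\<close>.\<close>
  proof (rule that[of "d / 2"])
    fix a and l :: real assume l: "0 < l" "l \<le> d / 2"
    have "ennreal (mean_oscillation (cube a l) f) \<le> ?S (d / 2)"
      using l by (intro SUP_upper2[of "(a, l)"]) auto
    also have "\<dots> \<le> ennreal \<epsilon>"
      using d by (intro less_imp_le) auto
    finally show "mean_oscillation (cube a l) f \<le> \<epsilon>"
      using assms(2) by simp
  qed (use d in simp)
qed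

text \<open>On a small cube \<open>f\<close> stays close to its value at the lower corner, by the
  modulus of continuity. This gives the inclusion in VMO that density comprises.\<close>

lemma C_modulus_BMO_subset_VMO:
  fixes f :: "real ^ 'n \<Rightarrow> complex"
  assumes \<Upsilon>: "modulus_of_continuity \<Upsilon>" and f: "f \<in> C_modulus \<Upsilon>" "f \<in> BMO"
  shows "f \<in> VMO"
proof -
  \<comment> \<open>The norm is at most the sum of the absolute coordinates, so points of a cube of
    side r lie within n * r of its lower corner.\<close>
  let ?d = "real CARD('n)"
  let ?S = "\<lambda>r. SUP (a, l) \<in> UNIV \<times> {0<..r}. ennreal (mean_oscillation (cube a l) f)"
  have L1: "f \<in> L1_loc"
    using f(2) by (simp add: BMO_def)
  have mono: "\<Upsilon> s \<le> \<Upsilon> r" if "0 \<le> s" "s \<le> r" for s r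
    using \<Upsilon> that by (auto simp: modulus_of_continuity_def mono_on_def)
  obtain C where C: "0 < C" "\<And>a b. ennreal (norm (f a - f b)) \<le> ennreal C * \<Upsilon> (norm (a - b))"
    using f(1) by (auto simp: C_modulus_def)
  \<comment> \<open>The modulus may take the value infinity, where the bound is trivial; elsewhere
    it is a real number and the estimate is done in the reals.\<close>
  have bound: "?S r \<le> ennreal (2 * C) * \<Upsilon> (?d * r)" if "0 < r" for r
  proof (cases "\<Upsilon> (?d * r) = \<infinity>")
    case True
    then show ?thesis
      using C(1) by (simp add: ennreal_mult_top)
  next
    case False
    then obtain v where v: "\<Upsilon> (?d * r) = ennreal v" "0 \<le> v"
      by (cases "\<Upsilon> (?d * r)") auto
    have "ennreal (mean_oscillation (cube a l) f) \<le> ennreal (2 * C * v)" if l: "0 < l" "l \<le> r" for a l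
    proof -
      have ptw: "norm (f x - f a) \<le> C * v" if x: "x \<in> cube a l" for x
      proof -
        have "norm (x - a) \<le> (\<Sum>i\<in>UNIV. \<bar>(x - a) $ i\<bar>)"
          by (rule norm_le_l1_cart)
        also have "\<dots> \<le> (\<Sum>i\<in>(UNIV :: 'n set). r)"
        proof (intro sum_mono)
          fix i
          have "a $ i \<le> x $ i \<and> x $ i \<le> a $ i + l"
            using x by (simp add: mem_cube)
          then show "\<bar>(x - a) $ i\<bar> \<le> r"
            using l by simp
        qed
        also have "\<dots> = ?d * r"
          by simp
        finally have "\<Upsilon> (norm (x - a)) \<le> ennreal v"
          using mono[of "norm (x - a)" "?d * r"] v by simp
        then have "ennreal (norm (f x - f a)) \<le> ennreal C * ennreal v"
          using C(2)[of x a] order_trans mult_left_mono by (metis zero_le)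
        then show ?thesis
          using C(1) v(2) by (simp add: ennreal_mult[symmetric])
      qed
      have "mean_oscillation (cube a l) f \<le> 2 * (LINT x:cube a l|lebesgue. norm (f x - f a)) / l ^ CARD('n)"
        by (intro mean_oscillation_le L1 l)
      also have "\<dots> \<le> 2 * (LINT x:cube a l|lebesgue. C * v) / l ^ CARD('n)"
        using l by (intro divide_right_mono mult_left_mono set_integral_mono ptw
            set_integrable_norm_diff_const L1 set_integrable_const_cube) auto
      also have "\<dots> = 2 * C * v"
        using l set_integral_const_cube[of l a "C * v"] by (simp del: set_integral_mult_right set_integral_mult_left)
      finally show ?thesis
        by (rule ennreal_leI)
    qed
    then show ?thesis
      using C(1) v by (auto intro!: SUP_least simp: ennreal_mult[symmetric])
  qed
  have "((\<lambda>r. \<Upsilon> (?d * r)) \<longlongrightarrow> 0) (at_right 0)"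
  proof (rule filterlim_compose[of \<Upsilon> "nhds 0" "at_right 0"])
    show "(\<Upsilon> \<longlongrightarrow> 0) (at_right 0)"
      using \<Upsilon> by (simp add: modulus_of_continuity_def)
    have "((\<lambda>r. ?d * r) \<longlongrightarrow> ?d * 0) (at_right 0)"
      by (intro tendsto_intros)
    then show "filterlim (\<lambda>r. ?d * r) (at_right 0) (at_right 0)"
      by (auto simp: filterlim_at eventually_at_right_less intro!: eventually_mono[OF eventually_at_right_less])
  qed
  then have "((\<lambda>r. ennreal (2 * C) * \<Upsilon> (?d * r)) \<longlongrightarrow> ennreal (2 * C) * 0) (at_right 0)"
    by (intro ennreal_tendsto_cmult) auto
  then have "((\<lambda>r. ennreal (2 * C) * \<Upsilon> (?d * r)) \<longlongrightarrow> 0) (at_right 0)"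
    by simp
  then have "(?S \<longlongrightarrow> 0) (at_right 0)"
    by (rule tendsto_sandwich[OF _ _ tendsto_const, rotated 2])
      (simp, rule eventually_mono[OF eventually_at_right_less], rule bound, assumption)
  then show ?thesis
    using f(2) by (simp add: VMO_def)
qed

section \<open>Approximation by the smaller space\<close>

definition regular_functions :: "(real \<Rightarrow> ennreal) \<Rightarrow> (real ^ 'n \<Rightarrow> complex) set" where
  "regular_functions \<Upsilon> = {f. f \<in> C_modulus \<Upsilon> \<inter> C_infinity \<inter> BMO \<and>
        (\<forall>\<alpha> :: 'n \<Rightarrow> nat. 1 \<le> (\<Sum>i\<in>UNIV. \<alpha> i) \<longrightarrow>
           multi_partial \<alpha> f \<in> C_modulus \<Upsilon> \<inter> L_infinity)}"

text \<open>All derivatives are mollifications with kernels of the same family, so one modulus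
  estimate for arbitrary \<open>c\<close> and \<open>m\<close> serves every order. Order at least 1
  means a nonempty list of directions, hence a kernel of integral 0 and a bounded
  derivative.\<close>

lemma smear_regular:
  fixes f :: "real ^ 'n \<Rightarrow> complex"
  assumes t: "0 < t" "t \<le> 1" and f: "f \<in> L1_loc"
    and osc: "\<And>a l. 0 < l \<Longrightarrow> mean_oscillation (cube a l) f \<le> \<beta>"
    and \<Upsilon>: "\<exists>C::real. 0 < C \<and> (\<forall>s\<ge>0. ennreal (Upsilon_sharp s) \<le> ennreal C * \<Upsilon> s)"
    and BMO: "smear (bump_kernel c m t) f \<in> BMO"
  shows "smear (bump_kernel c m t) f \<in> regular_functions \<Upsilon>"
proof -
  have modulus: "smear (bump_kernel c m t) f \<in> C_modulus \<Upsilon>" for c m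
  proof -
    obtain C where "0 < C" "\<And>a b. norm (smear (bump_kernel c m t) f a - smear (bump_kernel c m t) f b)
        \<le> C * Upsilon_sharp (norm (a - b))"
      using smear_Upsilon_sharp[OF t f osc] by blast
    then show ?thesis
      by (rule C_modulusI) (rule \<Upsilon>)
  qed
  have "multi_partial \<alpha> (smear (bump_kernel c m t) f) \<in> C_modulus \<Upsilon> \<inter> L_infinity"
    if \<alpha>: "1 \<le> (\<Sum>i\<in>UNIV. \<alpha> i)" for \<alpha> :: "'n \<Rightarrow> nat"
  proof -
    define xs where "xs = (SOME xs. \<forall>i. count_list xs i = \<alpha> i)"
    have "\<forall>i. count_list xs i = \<alpha> i"
      unfolding xs_def by (rule someI_ex) (rule ex_list_of_multi_index)
    then have "xs \<noteq> []"
      using \<alpha> by force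
    then obtain c' m' where eq: "iterated_partial xs (smear (bump_kernel c m t) f) = smear (bump_kernel c' m' t) f"
      and zero: "(LINT y|lebesgue. bump_kernel c' m' t y) = 0"
      using iterated_partial_smear[OF t(1) f, of xs c m] by metis
    obtain C where "\<And>x. norm (smear (bump_kernel c' m' t) f x) \<le> C"
      using smear_bounded[OF t(1) f osc zero] by blast
    then have "smear (bump_kernel c' m' t) f \<in> L_infinity"
      using continuous_on_smear[OF t(1) f osc]
      by (auto simp: L_infinity_def intro: borel_measurable_lebesgue_continuous)
    with modulus show ?thesis
      by (simp add: multi_partial_def eq flip: xs_def)
  qed
  then show ?thesis
    using modulus BMO smear_C_infinity[OF t(1) f osc] by (simp add: regular_functions_def)
qed

lemma VMO_approximation:
  fixes f :: "real ^ 'n \<Rightarrow> complex"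
  assumes f: "f \<in> VMO" and eps: "0 < \<epsilon>"
    and \<Upsilon>: "\<exists>C::real. 0 < C \<and> (\<forall>s\<ge>0. ennreal (Upsilon_sharp s) \<le> ennreal C * \<Upsilon> s)"
  obtains F where "F \<in> regular_functions \<Upsilon>" "BMO_seminorm (\<lambda>x. f x - F x) \<le> ennreal \<epsilon>"
proof -
  define M :: real where "M = 2 * exp 8"
  \<comment> \<open>The factor of the mollification error; oscillation at most \<epsilon> / K at
    small scales yields an error of at most \<epsilon>.\<close>
  define K where "K = 1 + 2 * 2 ^ CARD('n) * (2 ^ CARD('n) + (2 * M) ^ CARD('n))"
  have M: "0 \<le> M"
    by (simp add: M_def)
  have K: "0 < K"
    using M by (simp add: K_def add_pos_nonneg)
  have L1: "f \<in> L1_loc" and BMO: "f \<in> BMO"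
    using f by (auto simp: VMO_def BMO_def)
  obtain \<beta> where \<beta>: "\<And>a l. 0 < l \<Longrightarrow> mean_oscillation (cube a l) f \<le> \<beta>"
    using BMO_mean_oscillation_bound[OF BMO] by blast
  obtain \<delta> where \<delta>: "0 < \<delta>" "\<And>a l. 0 < l \<Longrightarrow> l \<le> \<delta> \<Longrightarrow> mean_oscillation (cube a l) f \<le> \<epsilon> / K"
    using VMO_small_oscillation[OF f, of "\<epsilon> / K"] eps K by auto
  \<comment> \<open>The growth estimates ask for t <= 1, the error estimate for small oscillation on
    cubes of side up to 2t.\<close>
  define t where "t = min 1 (\<delta> / 2)"
  have t: "0 < t" "t \<le> 1" "2 * t \<le> \<delta>"
    using \<delta>(1) by (auto simp: t_def)
  obtain c where c: "\<And>x. \<bar>bump_kernel c (\<lambda>_. 0) t (x :: real ^ 'n)\<bar> \<le> (M / t) ^ CARD('n)"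
    "(LINT y|lebesgue. bump_kernel c (\<lambda>_. 0) t (y :: real ^ 'n)) = 1"
    using exists_mollifier[OF t(1)] unfolding M_def by blast
  let ?F = "smear (bump_kernel c (\<lambda>_. 0) t) f"
  have F: "?F \<in> L1_loc"
    by (rule L1_loc_continuous[OF continuous_on_smear[OF t(1) L1 \<beta>]])
  have small: "mean_oscillation (cube a l) f \<le> \<epsilon> / K" if "0 < l" "l \<le> 2 * t" for a l
    using \<delta>(2) that t(3) by simp
  have diff: "mean_oscillation (cube a l) (\<lambda>x. f x - ?F x) \<le> K * (\<epsilon> / K)" if "0 < l" for a l
    using smear_mollifier_oscillation[OF t(1) L1 M c F small that] unfolding K_def[symmetric] .
  \<comment> \<open>Writing \<open>?F\<close> as f - (f - \<open>?F\<close>) derives its BMO bound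
    from those of \<open>f\<close> and of the error.\<close>
  have "mean_oscillation (cube a l) ?F \<le> \<beta> + \<epsilon>" if "0 < l" for a l
  proof -
    have "mean_oscillation (cube a l) (\<lambda>x. f x - (f x - ?F x))
        \<le> mean_oscillation (cube a l) f + mean_oscillation (cube a l) (\<lambda>x. f x - ?F x)"
      by (intro mean_oscillation_diff_le L1 L1_loc_diff F that)
    then show ?thesis
      using diff[OF that, of a] \<beta>[OF that, of a] K by simp
  qed
  then have "BMO_seminorm ?F \<le> ennreal (\<beta> + \<epsilon>)"
    by (rule BMO_seminorm_leI)
  then have "?F \<in> BMO"
    using F by (auto simp: BMO_def intro: order_le_less_trans)
  then have "?F \<in> regular_functions \<Upsilon>"
    using smear_regular[OF t(1,2) L1 \<beta> \<Upsilon>] by blast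
  moreover have "BMO_seminorm (\<lambda>x. f x - ?F x) \<le> ennreal \<epsilon>"
    using BMO_seminorm_leI[OF diff] K by simp
  ultimately show thesis
    by (rule that)
qed

theorem theorem1p5:
  fixes \<Upsilon> :: "real \<Rightarrow> ennreal"
  assumes "modulus_of_continuity \<Upsilon>"
    and "\<exists>C::real. 0 < C \<and> (\<forall>s\<ge>0. ennreal (Upsilon_sharp s) \<le> ennreal C * \<Upsilon> s)"
  shows "dense_in_VMO (C_modulus \<Upsilon> \<inter> C_infinity \<inter> BMO :: (real ^ 'n \<Rightarrow> complex) set)
    \<and> dense_in_VMO {f :: real ^ 'n \<Rightarrow> complex.
        f \<in> C_modulus \<Upsilon> \<inter> C_infinity \<inter> BMO \<and>
        (\<forall>\<alpha> :: 'n \<Rightarrow> nat. 1 \<le> (\<Sum>i\<in>UNIV. \<alpha> i) \<longrightarrow>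
           multi_partial \<alpha> f \<in> C_modulus \<Upsilon> \<inter> L_infinity)}"
proof -
  let ?X = "C_modulus \<Upsilon> \<inter> C_infinity \<inter> BMO :: (real ^ 'n \<Rightarrow> complex) set"
  let ?Y = "regular_functions \<Upsilon> :: (real ^ 'n \<Rightarrow> complex) set"
  have Y_sub: "?Y \<subseteq> ?X"
    by (auto simp: regular_functions_def)
  have X_sub: "?X \<subseteq> VMO"
    using C_modulus_BMO_subset_VMO[OF assms(1)] by blast
  have approx: "\<exists>F. (\<forall>j. F j \<in> ?Y) \<and> (\<lambda>j. BMO_seminorm (\<lambda>x. f x - F j x)) \<longlonglongrightarrow> 0"
    if f: "f \<in> VMO" for f :: "real ^ 'n \<Rightarrow> complex"
  proof -
    have "\<exists>F. F \<in> ?Y \<and> BMO_seminorm (\<lambda>x. f x - F x) \<le> ennreal (1 / real (Suc j))" for j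
    proof -
      have "0 < 1 / real (Suc j)"
        by simp
      from VMO_approximation[OF f this assms(2)] show ?thesis
        by blast
    qed
    then obtain F where F: "\<And>j. F j \<in> ?Y" "\<And>j. BMO_seminorm (\<lambda>x. f x - F j x) \<le> ennreal (1 / real (Suc j))"
      by metis
    have "(\<lambda>j. ennreal (1 / real (Suc j))) \<longlonglongrightarrow> ennreal 0"
      using LIMSEQ_inverse_real_of_nat by (intro tendsto_ennrealI) (simp add: inverse_eq_divide)
    then have "(\<lambda>j. BMO_seminorm (\<lambda>x. f x - F j x)) \<longlonglongrightarrow> 0"
      unfolding ennreal_0 by (rule tendsto_sandwich[OF _ _ tendsto_const, rotated 2])
        (intro always_eventually allI zero_le F(2))+
    with F(1) show ?thesis
      by blast
  qed
  have "dense_in_VMO ?Y"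
    using approx Y_sub X_sub by (auto simp: dense_in_VMO_def)
  \<comment> \<open>The approximants from the smaller space also serve the larger one, which is
    still contained in VMO.\<close>
  moreover have "dense_in_VMO ?X"
    using approx Y_sub X_sub unfolding dense_in_VMO_def by (meson subsetD)
  ultimately show ?thesis
    by (simp add: regular_functions_def)
qed

end
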